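(* Let $Y_i\sim \mathrm{Poi}(\theta_i)$ independently for $i=1,\dots,n$, where each $\theta_i$ is generated from the two-group model $\theta_i \overset{iid}{\sim} (1-p)\,Ga(\alpha,\beta)+p\,Ga(\alpha,\beta+\delta)$, with latent indicators $\nu_i$. Suppose we test $H_{0i}:\nu_i=0$ against $H_{1i}:\nu_i=1$ simultaneously for $i=1,\dots,n$ using the empirical Bayes rule: reject $H_{0i}$ if $1-\mathbb{E}(\kappa_i\mid Y_i,\widehat\tau)>\frac{\delta}{2(\delta+1)}$, where $\widehat\tau=\max\big\{\frac1n,\frac1n\sum_{j=1}^n\mathbf 1\{Y_j\ge1\}\big\}$ and the posterior mean is computed under the one-group prior with parameters $\alpha$, $\tau$, $a$, $L$, $K$ described in the context and then evaluated at $\tau=\widehat\tau$. Assume that $L$ satisfies conditions (A1) and (A2) given in the context, that $a>1$, that $p,\beta,\delta$ (and $\alpha$) satisfy Assumption 1 given in the context, and that $p\propto n^{-\epsilon}$ for some $0<\epsilon<1$. Let $R^{\mathrm{EB}}_{\mathrm{OG}}$ be the Bayes risk (with respect to additive $0$-$1$ loss) of this rule and $R^{\mathrm{BO}}_{\mathrm{Opt}}$ the Bayes risk of the optimal multiple testing rule (the Bayes Oracle). Then $$1\le \liminf_{n\to\infty}\frac{R^{\mathrm{EB}}_{\mathrm{OG}}}{R^{\mathrm{BO}}_{\mathrm{Opt}}}\le \limsup_{n\to\infty}\frac{R^{\mathrm{EB}}_{\mathrm{OG}}}{R^{\mathrm{BO}}_{\mathrm{Opt}}}\le (\delta+1)^{\alpha}\,\mathbb{P}\Big(Y\le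 2a+\alpha-\frac{2(a+\alpha)}{\delta+2}\Big),$$ where $Y\sim NB\big(\alpha,\frac{1}{\delta+1}\big)$.
   Context: Distributions: $\mathrm{Poi}(\theta)$ is the Poisson distribution with mean $\theta$. $Ga(\alpha_1,\alpha_2)$ is the Gamma distribution with shape $\alpha_1>0$ and scale $\alpha_2>0$, density $\frac{1}{\Gamma(\alpha_1)\alpha_2^{\alpha_1}}x^{\alpha_1-1}e^{-x/\alpha_2}$, $x>0$. $NB(\alpha,q)$ is the negative binomial distribution with size $\alpha>0$ and success probability $q$, with mass function $\binom{y+\alpha-1}{y}(1-q)^y q^{\alpha}$, $y=0,1,2,\dots$. Two-group (true) model: $\nu_1,\dots,\nu_n$ are independent with $P(\nu_i=1)=p=1-P(\nu_i=0)$; given $\nu_i=0$, $\theta_i\sim Ga(\alpha,\beta)$; given $\nu_i=1$, $\theta_i\sim Ga(\alpha,\beta+\delta)$ (independently over $i$); given $\theta_i$, $Y_i\sim \mathrm{Poi}(\theta_i)$ independently. Hence marginally $Y_i\sim NB(\alpha,\frac1{\beta+1})$ under $H_{0i}$ and $Y_i\sim NB(\alpha,\frac{1}{\beta+\delta+1})$ under $H_{1i}$. Bayes risk: for a multiple testing rule with type I error $t_{1i}=P_{H_{0i}}(H_{0i}\text{ rejected})$ and type II error $t_{2i}=P_{H_{1i}}(H_{0i}\text{ accepted})$ for the $i$-th test (under $P_{H_{0i}}$, resp. $P_{H_{1i}}$, one conditions on $\nu_i=0$, resp. $\nu_i=1$, while the other $Y_j$, $j\ne i$, follow the two-group mixture),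 the Bayes risk under additive $0$-$1$ loss is $R=\sum_{i=1}^n[(1-p)t_{1i}+p\,t_{2i}]$. The Bayes Oracle is the rule minimizing $R$; it rejects $H_{0i}$ iff $f_{H_{1i}}(Y_i)/f_{H_{0i}}(Y_i)>(1-p)/p$, where $f_{H_{0i}},f_{H_{1i}}$ are the marginal mass functions of $Y_i$ under $H_{0i},H_{1i}$. Assumption 1: as $n\to\infty$, $p=p_n\to 0$; $\alpha$ and $\delta$ are fixed and bounded away from both $0$ and infinity; and $\beta=\beta_n\propto p^{C_1}$ for some constant $C_1>1$. One-group prior (used only to define the rule): given $\tau>0$ and $\lambda_i$, $\theta_i\sim Ga(\alpha,\lambda_i^2\tau^2)$ independently, and $\lambda_i^2$ has density $\pi_1(\lambda_i^2)=K(\lambda_i^2)^{-a-1}L(\lambda_i^2)$ on $(0,\infty)$, where $K>0$ is the normalizing constant, $a>0$ is fixed, and $L:(0,\infty)\to(0,\infty)$ is a measurable non-constant slowly varying function (i.e. $L(cx)/L(x)\to1$ as $x\to\infty$ for every $c>0$). Put $\kappa_i=1/(1+\lambda_i^2\tau^2)$. The posterior density of $\kappa_i$ is $\pi(\kappa_i\mid Y_i,\tau)\propto \kappa_i^{a+\alpha-1}(1-\kappa_i)^{Y_i-a-1}L\big(\frac{1}{\tau^2}(\frac1{\kappa_i}-1)\big)$, $0<\kappa_i<1$, and $\mathbb{E}(\kappa_i\mid Y_i,\tau)$ is its mean; $\mathbb{E}(\kappa_i\mid Y_i,\widehat\tau)$ is this function of $(Y_i,\tau)$ evaluated at $\tau=\widehat\tau$.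 (A1) There exist $c_0>0$ and $t_0>0$ (depending on $L$ and $c_0$) with $L(t)\ge c_0$ for all $t\ge t_0$, and $\lim_{t\to\infty}L(t)\in(0,\infty)$. (A2) There exists $M\in(0,\infty)$ with $\sup_{t\in(0,\infty)}L(t)\le M$. *)

theory Defs
  imports "HOL-Probability.Probability"
begin

section \<open>Distributions\<close>

definition gamma_density :: "real \<Rightarrow> real \<Rightarrow> real \<Rightarrow> real" where
  "gamma_density k s x =
     (if 0 < x then x powr (k - 1) * exp (- x / s) / (Gamma k * s powr k) else 0)"

definition gamma_distr :: "real \<Rightarrow> real \<Rightarrow> real measure" where
  "gamma_distr k s = density lborel (\<lambda>x. ennreal (gamma_density k s x))"

text \<open>
  The library constant \<^const>\<open>poisson_pmf\<close> is specified for positive rates only; the totalization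
  makes this a measurable kernel on all of \<^typ>\<open>real\<close>.
\<close>

definition poi :: "real \<Rightarrow> nat pmf" where
  "poi \<theta> = (if 0 < \<theta> then poisson_pmf \<theta> else return_pmf 0)"

text \<open>Negative binomial distribution with real size and success probability \<open>q\<close>.\<close>

definition nb_mass :: "real \<Rightarrow> real \<Rightarrow> nat \<Rightarrow> real" where
  "nb_mass r q y = ((real y + r - 1) gchoose y) * (1 - q) ^ y * q powr r"

definition nb_distr :: "real \<Rightarrow> real \<Rightarrow> nat measure" where
  "nb_distr r q = density (count_space UNIV) (\<lambda>y. ennreal (nb_mass r q y))"


section \<open>The two-group model\<close>

text \<open>
  Joint law of one triple \<open>(\<nu>\<^sub>i, \<theta>\<^sub>i, Y\<^sub>i)\<close>, and of \<open>n\<close> independent triples, which are indexed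
  by \<open>i < n\<close>. The value \<open>\<nu>\<^sub>i = True\<close> means that the alternative holds.
\<close>

abbreviation triple_space :: "(bool \<times> real \<times> nat) measure" where
  "triple_space \<equiv> count_space UNIV \<Otimes>\<^sub>M (borel \<Otimes>\<^sub>M count_space UNIV)"

definition two_group :: "real \<Rightarrow> real \<Rightarrow> real \<Rightarrow> real \<Rightarrow> (bool \<times> real \<times> nat) measure" where
  "two_group \<alpha> \<beta> \<delta> p =
     measure_pmf (bernoulli_pmf p) \<bind> (\<lambda>\<nu>.
     gamma_distr \<alpha> (if \<nu> then \<beta> + \<delta> else \<beta>) \<bind> (\<lambda>\<theta>.
     measure_pmf (poi \<theta>) \<bind> (\<lambda>y.
     return triple_space (\<nu>, \<theta>, y))))"

definition two_group_model ::
    "real \<Rightarrow> real \<Rightarrow> real \<Rightarrow> real \<Rightarrow> nat \<Rightarrow> (nat \<Rightarrow> bool \<times> real \<times> nat) measure" where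
  "two_group_model \<alpha> \<beta> \<delta> p n = PiM {..<n} (\<lambda>_. two_group \<alpha> \<beta> \<delta> p)"

definition latent :: "(nat \<Rightarrow> bool \<times> real \<times> nat) \<Rightarrow> nat \<Rightarrow> bool" where
  "latent \<omega> i = fst (\<omega> i)"

definition observed :: "nat \<Rightarrow> (nat \<Rightarrow> bool \<times> real \<times> nat) \<Rightarrow> nat \<Rightarrow> nat" where
  "observed n \<omega> = (\<lambda>i\<in>{..<n}. snd (snd (\<omega> i)))"


section \<open>Multiple testing rules and their Bayes risk\<close>

text \<open>
  \<open>\<phi> Y i\<close> means that the \<open>i\<close>-th null hypothesis is rejected on the data \<open>Y\<close>. Only the entries
  \<open>Y j\<close> with \<open>j < n\<close> carry data, so every \<open>\<phi>\<close> depends on countably many data vectors and no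
  measurability condition is needed.
\<close>

type_synonym testing_rule = "(nat \<Rightarrow> nat) \<Rightarrow> nat \<Rightarrow> bool"

definition type1_error ::
    "real \<Rightarrow> real \<Rightarrow> real \<Rightarrow> real \<Rightarrow> nat \<Rightarrow> testing_rule \<Rightarrow> nat \<Rightarrow> real" where
  "type1_error \<alpha> \<beta> \<delta> p n \<phi> i =
     \<P>(\<omega> in two_group_model \<alpha> \<beta> \<delta> p n. \<phi> (observed n \<omega>) i \<bar> \<not> latent \<omega> i)"

definition type2_error ::
    "real \<Rightarrow> real \<Rightarrow> real \<Rightarrow> real \<Rightarrow> nat \<Rightarrow> testing_rule \<Rightarrow> nat \<Rightarrow> real" where
  "type2_error \<alpha> \<beta> \<delta> p n \<phi> i =
     \<P>(\<omega> in two_group_model \<alpha> \<beta> \<delta> p n. \<not> \<phi> (observed n \<omega>) i \<bar> latent \<omega> i)"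

definition bayes_risk ::
    "real \<Rightarrow> real \<Rightarrow> real \<Rightarrow> real \<Rightarrow> nat \<Rightarrow> testing_rule \<Rightarrow> real" where
  "bayes_risk \<alpha> \<beta> \<delta> p n \<phi> =
     (\<Sum>i<n. (1 - p) * type1_error \<alpha> \<beta> \<delta> p n \<phi> i + p * type2_error \<alpha> \<beta> \<delta> p n \<phi> i)"

text \<open>Marginal mass function of an observation given \<open>\<nu>\<close>.\<close>

definition marginal_mass :: "real \<Rightarrow> real \<Rightarrow> real \<Rightarrow> real \<Rightarrow> bool \<Rightarrow> nat \<Rightarrow> real" where
  "marginal_mass \<alpha> \<beta> \<delta> p \<nu> y = \<P>(x in two_group \<alpha> \<beta> \<delta> p. snd (snd x) = y \<bar> fst x = \<nu>)"

definition bayes_oracle :: "real \<Rightarrow> real \<Rightarrow> real \<Rightarrow> real \<Rightarrow> testing_rule" where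
  "bayes_oracle \<alpha> \<beta> \<delta> p Y i \<longleftrightarrow>
     (1 - p) / p < marginal_mass \<alpha> \<beta> \<delta> p True (Y i) / marginal_mass \<alpha> \<beta> \<delta> p False (Y i)"


section \<open>The one-group prior and the empirical Bayes rule\<close>

definition slowly_varying :: "(real \<Rightarrow> real) \<Rightarrow> bool" where
  "slowly_varying L \<longleftrightarrow> (\<forall>c>0. ((\<lambda>x. L (c * x) / L x) \<longlongrightarrow> 1) at_top)"

text \<open>\<open>L\<close> is a function on \<open>(0, \<infinity>)\<close>; its values at nonpositive arguments are irrelevant.\<close>

definition one_group_prior :: "real \<Rightarrow> (real \<Rightarrow> real) \<Rightarrow> real \<Rightarrow> bool" where
  "one_group_prior a L K \<longleftrightarrow>
     L \<in> borel_measurable (restrict_space borel {0<..}) \<and>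
     (\<forall>x>0. 0 < L x) \<and>
     (\<exists>x>0. \<exists>y>0. L x \<noteq> L y) \<and>
     slowly_varying L \<and>
     0 < K \<and>
     (\<integral>\<^sup>+x\<in>{0<..}. ennreal (K * x powr (- a - 1) * L x) \<partial>lborel) = 1"

definition condition_A1 :: "(real \<Rightarrow> real) \<Rightarrow> bool" where
  "condition_A1 L \<longleftrightarrow>
     (\<exists>c0>0. \<exists>t0>0. \<forall>t\<ge>t0. c0 \<le> L t) \<and> (\<exists>l>0. (L \<longlongrightarrow> l) at_top)"

definition condition_A2 :: "(real \<Rightarrow> real) \<Rightarrow> bool" where
  "condition_A2 L \<longleftrightarrow> (\<exists>M>0. \<forall>t>0. L t \<le> M)"

text \<open>
  Unnormalized posterior density on \<open>(0, 1)\<close> of the shrinkage weight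
  \<open>\<kappa> = 1 / (1 + \<lambda>\<^sup>2 \<tau>\<^sup>2)\<close> given one observation \<open>y\<close>, and the posterior mean.
\<close>

definition kappa_kernel ::
    "real \<Rightarrow> real \<Rightarrow> (real \<Rightarrow> real) \<Rightarrow> nat \<Rightarrow> real \<Rightarrow> real \<Rightarrow> real" where
  "kappa_kernel \<alpha> a L y \<tau> \<kappa> =
     \<kappa> powr (a + \<alpha> - 1) * (1 - \<kappa>) powr (real y - a - 1) * L (1 / \<tau>\<^sup>2 * (1 / \<kappa> - 1))"

definition kappa_posterior_mean ::
    "real \<Rightarrow> real \<Rightarrow> (real \<Rightarrow> real) \<Rightarrow> nat \<Rightarrow> real \<Rightarrow> real" where
  "kappa_posterior_mean \<alpha> a L y \<tau> =
     (LBINT \<kappa>:{0<..<1}. \<kappa> * kappa_kernel \<alpha> a L y \<tau> \<kappa>) / (LBINT \<kappa>:{0<..<1}. kappa_kernel \<alpha> a L y \<tau> \<kappa>)"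

definition tau_hat :: "nat \<Rightarrow> (nat \<Rightarrow> nat) \<Rightarrow> real" where
  "tau_hat n Y = max (1 / real n) (1 / real n * (\<Sum>j<n. of_bool (1 \<le> Y j)))"

definition eb_rule :: "real \<Rightarrow> real \<Rightarrow> real \<Rightarrow> (real \<Rightarrow> real) \<Rightarrow> nat \<Rightarrow> testing_rule" where
  "eb_rule \<alpha> \<delta> a L n Y i \<longleftrightarrow>
     1 - kappa_posterior_mean \<alpha> a L (Y i) (tau_hat n Y) > \<delta> / (2 * (\<delta> + 1))"


section \<open>Asymptotics\<close>

definition eventually_proportional :: "(nat \<Rightarrow> real) \<Rightarrow> (nat \<Rightarrow> real) \<Rightarrow> bool"
    (infix "\<propto>" 50) where
  "f \<propto> g \<longleftrightarrow> (\<exists>c>0. \<forall>\<^sub>F n in sequentially. f n = c * g n)"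

definition assumption1 :: "real \<Rightarrow> (nat \<Rightarrow> real) \<Rightarrow> real \<Rightarrow> (nat \<Rightarrow> real) \<Rightarrow> bool" where
  "assumption1 \<alpha> \<beta> \<delta> p \<longleftrightarrow>
     (\<forall>n. 0 < p n \<and> p n < 1) \<and> p \<longlonglongrightarrow> 0 \<and>
     0 < \<alpha> \<and> 0 < \<delta> \<and>
     (\<forall>n. 0 < \<beta> n) \<and> (\<exists>C1>1. \<beta> \<propto> (\<lambda>n. p n powr C1))"


section \<open>Optimality of the Bayes oracle\<close>

text \<open>
  The likelihood ratio rule minimizes the Bayes risk among all multiple testing rules: see
  \<open>bayes_oracle_minimizes\<close> below. The other facts only serve to prove this.
\<close>

lemma gamma_density_nonneg: "0 < k \<Longrightarrow> 0 < s \<Longrightarrow> 0 \<le> gamma_density k s x"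
  by (simp add: gamma_density_def Gamma_real_pos less_imp_le)

lemma gamma_density_measurable [measurable]: "gamma_density k s \<in> borel_measurable borel"
  unfolding gamma_density_def by measurable

lemma prob_space_gamma_distr:
  assumes "0 < k" "0 < s"
  shows "prob_space (gamma_distr k s)"
proof
  have "(\<integral>\<^sup>+x. ennreal (gamma_density k s x) \<partial>lborel) =
      (\<integral>\<^sup>+x. ennreal (gamma_density k s (0 + s * x)) \<partial>lborel) * ennreal \<bar>s\<bar>"
    using assms by (subst nn_integral_real_affine[where t = 0 and c = s])
      (auto simp: nn_integral_cmult mult.commute)
  also have "\<dots> = (\<integral>\<^sup>+x. ennreal (indicator {0..} x * (x powr (k - 1) / exp x)) * ennreal (1 / (Gamma k * s)) \<partial>lborel) * ennreal s"
  proof (intro arg_cong2[where f = "(*)"] nn_integral_cong_AE)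
    have "AE x in lborel. x \<noteq> (0::real)" by (rule AE_lborel_singleton)
    then show "AE x in lborel. ennreal (gamma_density k s (0 + s * x)) =
        ennreal (indicator {0..} x * (x powr (k - 1) / exp x)) * ennreal (1 / (Gamma k * s))"
    proof eventually_elim
      case (elim x)
      have "0 < Gamma k" using assms by (simp add: Gamma_real_pos)
      then show ?case using assms elim
        by (auto simp: gamma_density_def zero_less_mult_iff indicator_def powr_mult powr_diff
            exp_minus field_simps simp flip: ennreal_mult')
    qed
  qed (use assms in auto)
  also have "\<dots> = ennreal (Gamma k) * ennreal (1 / (Gamma k * s)) * ennreal s"
    by (subst nn_integral_multc) (auto simp: Gamma_conv_nn_integral_real[OF assms(1)])
  also have "\<dots> = ennreal (Gamma k * (1 / (Gamma k * s)) * s)"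
    using assms Gamma_real_pos[OF assms(1)]
    by (subst ennreal_mult, simp, simp, subst ennreal_mult) simp_all
  also have "\<dots> = 1"
    using assms less_imp_neq[OF Gamma_real_pos[OF assms(1)], symmetric] by simp
  finally show "emeasure (gamma_distr k s) (space (gamma_distr k s)) = 1"
    by (simp add: gamma_distr_def emeasure_density)
qed

lemma sets_gamma_distr [simp, measurable_cong]: "sets (gamma_distr k s) = sets borel"
  by (simp add: gamma_distr_def)

lemma poi_measurable [measurable]: "(\<lambda>\<theta>. measure_pmf (poi \<theta>)) \<in> borel \<rightarrow>\<^sub>M prob_algebra (count_space UNIV)"
proof (rule measurable_prob_algebraI)
  show "(\<lambda>\<theta>. measure_pmf (poi \<theta>)) \<in> borel \<rightarrow>\<^sub>M subprob_algebra (count_space UNIV)"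
  proof (rule measurable_subprob_algebra)
    fix A :: "nat set"
    have "(\<lambda>\<theta>. emeasure (measure_pmf (poi \<theta>)) A) =
      (\<lambda>\<theta>. \<Sum>y. ennreal (if 0 < \<theta> then \<theta> ^ y / fact y * exp (- \<theta>) else if y = 0 then 1 else 0) * indicator A y)"
    proof
      fix \<theta>
      have "emeasure (measure_pmf (poi \<theta>)) A = (\<integral>\<^sup>+y. ennreal (pmf (poi \<theta>) y) * indicator A y \<partial>count_space UNIV)"
        by (subst nn_integral_measure_pmf[symmetric]) simp
      also have "\<dots> = (\<Sum>y. ennreal (pmf (poi \<theta>) y) * indicator A y)"
        by (simp add: nn_integral_count_space_nat)
      finally show "emeasure (measure_pmf (poi \<theta>)) A = 
         (\<Sum>y. ennreal (if 0 < \<theta> then \<theta> ^ y / fact y * exp (- \<theta>) else if y = 0 then 1 else 0) * indicator A y)"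
        by (auto simp: poi_def pmf_return indicator_def intro!: suminf_cong)
    qed
    then show "(\<lambda>\<theta>. emeasure (measure_pmf (poi \<theta>)) A) \<in> borel_measurable borel"
      by simp
  qed (auto simp: measure_pmf.subprob_space_axioms)
qed (simp add: measure_pmf.prob_space_axioms)

definition group_kernel where
  "group_kernel \<nu> k s = gamma_distr k s \<bind> (\<lambda>\<theta>. measure_pmf (poi \<theta>) \<bind> (\<lambda>y. return triple_space (\<nu>, \<theta>, y)))"

lemma gamma_in_prob_algebra: "0 < k \<Longrightarrow> 0 < s \<Longrightarrow> gamma_distr k s \<in> space (prob_algebra borel)"
  by (simp add: space_prob_algebra prob_space_gamma_distr)

lemma observation_kernel_measurable [measurable]:
  "(\<lambda>\<theta>. measure_pmf (poi \<theta>) \<bind> (\<lambda>y. return triple_space (\<nu>, \<theta>, y))) \<in> borel \<rightarrow>\<^sub>M prob_algebra triple_space"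
  by measurable

lemma group_kernel_space: "0 < k \<Longrightarrow> 0 < s \<Longrightarrow> group_kernel \<nu> k s \<in> space (prob_algebra triple_space)"
  unfolding group_kernel_def space_prob_algebra
  by (auto intro!: prob_space_bind' gamma_in_prob_algebra observation_kernel_measurable sets_bind'[OF gamma_in_prob_algebra observation_kernel_measurable])

lemma two_group_eq: "two_group \<alpha> \<beta> \<delta> p = measure_pmf (bernoulli_pmf p) \<bind> (\<lambda>\<nu>. group_kernel \<nu> \<alpha> (if \<nu> then \<beta> + \<delta> else \<beta>))"
  by (simp add: two_group_def group_kernel_def)

context
  fixes \<alpha> \<beta> \<delta> p :: real
  assumes pos: "0 < \<alpha>" "0 < \<beta>" "0 < \<delta>" and p: "0 < p" "p < 1"
begin

lemma group_kernel_measurable: "(\<lambda>\<nu>. group_kernel \<nu> \<alpha> (if \<nu> then \<beta> + \<delta> else \<beta>)) \<in> count_space UNIV \<rightarrow>\<^sub>M prob_algebra triple_space"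
  using pos by (auto intro!: measurable_count_space_eq1[THEN iffD2] group_kernel_space)

lemma bernoulli_in_prob_algebra: "measure_pmf (bernoulli_pmf p) \<in> space (prob_algebra (count_space UNIV))"
  by (simp add: space_prob_algebra measure_pmf.prob_space_axioms)

lemma prob_space_two_group: "prob_space (two_group \<alpha> \<beta> \<delta> p)"
  unfolding two_group_eq by (rule prob_space_bind'[OF bernoulli_in_prob_algebra group_kernel_measurable])

lemma sets_two_group [simp, measurable_cong]: "sets (two_group \<alpha> \<beta> \<delta> p) = sets triple_space"
  unfolding two_group_eq by (rule sets_bind'[OF bernoulli_in_prob_algebra group_kernel_measurable])

lemma space_two_group [simp]: "space (two_group \<alpha> \<beta> \<delta> p) = UNIV"
  using sets_eq_imp_space_eq[OF sets_two_group] by (simp add: space_pair_measure)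

lemma emeasure_two_group:
  assumes "A \<in> sets triple_space"
  shows "emeasure (two_group \<alpha> \<beta> \<delta> p) A =
    ennreal p * emeasure (group_kernel True \<alpha> (\<beta> + \<delta>)) A + ennreal (1 - p) * emeasure (group_kernel False \<alpha> \<beta>) A"
  unfolding two_group_eq using p
  by (subst emeasure_bind_prob_algebra[OF bernoulli_in_prob_algebra group_kernel_measurable assms]) (simp add: nn_integral_measure_pmf nn_integral_count_space_finite UNIV_bool)

lemma emeasure_group_kernel:
  assumes "A \<in> sets triple_space" "0 < s"
  shows "emeasure (group_kernel \<nu> \<alpha> s) A = 
    (\<integral>\<^sup>+\<theta>. ennreal (gamma_density \<alpha> s \<theta>) * emeasure (measure_pmf (poi \<theta>)) {y. (\<nu>, \<theta>, y) \<in> A} \<partial>lborel)"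
proof -
  have pm: "measure_pmf (poi \<theta>) \<in> space (prob_algebra (count_space UNIV))" for \<theta>
    by (simp add: space_prob_algebra measure_pmf.prob_space_axioms)
  have rm: "(\<lambda>y. return triple_space (\<nu>, \<theta>, y)) \<in> count_space UNIV \<rightarrow>\<^sub>M prob_algebra triple_space" for \<theta>
    by measurable
  have *: "emeasure (measure_pmf (poi \<theta>) \<bind> (\<lambda>y. return triple_space (\<nu>, \<theta>, y))) A =
     emeasure (measure_pmf (poi \<theta>)) {y. (\<nu>, \<theta>, y) \<in> A}" for \<theta>
  proof -
    have "emeasure (measure_pmf (poi \<theta>) \<bind> (\<lambda>y. return triple_space (\<nu>, \<theta>, y))) A
       = (\<integral>\<^sup>+y. indicator {y. (\<nu>, \<theta>, y) \<in> A} y \<partial>measure_pmf (poi \<theta>))"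
      using assms(1) by (subst emeasure_bind_prob_algebra[OF pm rm assms(1)], intro nn_integral_cong) (simp add: indicator_def)
    then show ?thesis by (subst (asm) nn_integral_indicator) auto
  qed
  have m: "(\<lambda>\<theta>. emeasure (measure_pmf (poi \<theta>) \<bind> (\<lambda>y. return triple_space (\<nu>, \<theta>, y))) A) \<in> borel_measurable borel"
    using assms(1) measurable_prob_algebraD[OF observation_kernel_measurable[of \<nu>]] by (rule measurable_emeasure_kernel[rotated])
  then show ?thesis
    using assms pos m
    unfolding group_kernel_def
    by (subst emeasure_bind_prob_algebra[OF gamma_in_prob_algebra observation_kernel_measurable assms(1)])
       (auto simp: * gamma_distr_def nn_integral_density)
qed

lemma prob_space_group_kernel: "0 < s \<Longrightarrow> prob_space (group_kernel \<nu> \<alpha> s)" "0 < s \<Longrightarrow> sets (group_kernel \<nu> \<alpha> s) = sets triple_space"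
  using group_kernel_space[of \<alpha> s \<nu>] pos by (auto simp: space_prob_algebra)

lemma group_kernel_UNIV: "0 < s \<Longrightarrow> emeasure (group_kernel \<nu> \<alpha> s) UNIV = 1"
  using prob_space.emeasure_space_1[OF prob_space_group_kernel(1)] sets_eq_imp_space_eq[OF prob_space_group_kernel(2)]
  by (auto simp: space_pair_measure)

lemma group_kernel_fst: "0 < s \<Longrightarrow> emeasure (group_kernel \<nu> \<alpha> s) {x. fst x = b} = (if \<nu> = b then 1 else 0)"
proof -
  assume s: "0 < s"
  have "{x\<in>space triple_space. fst x = b} \<in> sets triple_space" by measurable
  then have m: "{x::bool\<times>real\<times>nat. fst x = b} \<in> sets triple_space" by (simp add: space_pair_measure)
  have m2: "UNIV \<in> sets triple_space" using sets.top[of triple_space] by (simp add: space_pair_measure)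
  show ?thesis
    using emeasure_group_kernel[OF m s, of \<nu>] emeasure_group_kernel[OF m2 s, of \<nu>] group_kernel_UNIV[OF s, of \<nu>]
    by auto
qed

lemma sets_fst: "{x::bool\<times>real\<times>nat. fst x = b} \<in> sets triple_space"
proof -
  have "{x\<in>space triple_space. fst x = b} \<in> sets triple_space" by measurable
  then show ?thesis by (simp add: space_pair_measure)
qed

lemma sets_fst_snd: "{x::bool\<times>real\<times>nat. snd (snd x) = y \<and> fst x = b} \<in> sets triple_space"
proof -
  have "{x\<in>space triple_space. snd (snd x) = y \<and> fst x = b} \<in> sets triple_space" by measurable
  then show ?thesis by (simp add: space_pair_measure)
qed

lemma prob_fst: "measure (two_group \<alpha> \<beta> \<delta> p) {x. fst x = b} = (if b then p else 1 - p)"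
  using pos p by (simp add: measure_def emeasure_two_group[OF sets_fst] group_kernel_fst)

lemma prob_joint_pos: "0 < measure (two_group \<alpha> \<beta> \<delta> p) {x. snd (snd x) = y \<and> fst x = False}"
proof -
  interpret prob_space "two_group \<alpha> \<beta> \<delta> p" by (rule prob_space_two_group)
  let ?A = "{x::bool\<times>real\<times>nat. snd (snd x) = y \<and> fst x = False}"
  have "emeasure (group_kernel False \<alpha> \<beta>) ?A \<noteq> 0"
  proof
    assume "emeasure (group_kernel False \<alpha> \<beta>) ?A = 0"
    moreover have "emeasure (measure_pmf (poi \<theta>)) {y'. (False, \<theta>, y') \<in> ?A} = ennreal (pmf (poi \<theta>) y)" for \<theta>
    proof -
      have "{y'. (False, \<theta>, y') \<in> ?A} = {y}" by auto
      then show ?thesis by (simp only: emeasure_pmf_single)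
    qed
    moreover have pmf_meas: "(\<lambda>\<theta>. ennreal (pmf (poi \<theta>) y)) \<in> borel_measurable borel"
    proof -
      have "(\<lambda>\<theta>. emeasure (measure_pmf (poi \<theta>)) {y}) \<in> borel_measurable borel"
        by (rule measurable_emeasure_kernel[OF measurable_prob_algebraD[OF poi_measurable]]) simp
      then show ?thesis by (simp add: emeasure_pmf_single)
    qed
    ultimately have "AE \<theta> in lborel. ennreal (gamma_density \<alpha> \<beta> \<theta>) * ennreal (pmf (poi \<theta>) y) = 0"
      using emeasure_group_kernel[OF sets_fst_snd[of y False] pos(2), of False]
      by (subst nn_integral_0_iff_AE[symmetric]) auto
    then have "AE \<theta> in lborel. \<theta> \<notin> {1..2::real}"
    proof eventually_elim
      case (elim \<theta>)
      then show ?case using pos Gamma_real_pos[OF pos(1)]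
        by (cases "0 < \<theta>") (auto simp: gamma_density_def poi_def ennreal_eq_0_iff zero_less_mult_iff simp flip: ennreal_mult' dest!: less_le_trans[rotated] split: if_splits)
    qed
    then have "emeasure lborel {1..2::real} = 0"
      by (subst (asm) AE_iff_measurable[where N = "{1..2}"]) auto
    moreover have "emeasure lborel {1..2::real} = 1" by simp
    ultimately show False by (metis zero_neq_one)
  qed
  then have "emeasure (two_group \<alpha> \<beta> \<delta> p) ?A \<noteq> 0"
    using p by (subst emeasure_two_group[OF sets_fst_snd]) auto
  then show ?thesis by (simp add: emeasure_eq_measure zero_less_measure_iff)
qed

lemma marginal_mass_eq:
  "marginal_mass \<alpha> \<beta> \<delta> p b y = measure (two_group \<alpha> \<beta> \<delta> p) {x. snd (snd x) = y \<and> fst x = b} / (if b then p else 1 - p)"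
  using prob_fst[of b] by (simp add: marginal_mass_def cond_prob_def)

lemma oracle_iff:
  "bayes_oracle \<alpha> \<beta> \<delta> p Y i \<longleftrightarrow>
     measure (two_group \<alpha> \<beta> \<delta> p) {x. snd (snd x) = Y i \<and> fst x = False} < measure (two_group \<alpha> \<beta> \<delta> p) {x. snd (snd x) = Y i \<and> fst x = True}"
  using prob_joint_pos[of "Y i"] p unfolding bayes_oracle_def marginal_mass_eq
  by (simp add: divide_simps)

definition loss_event :: "nat \<Rightarrow> testing_rule \<Rightarrow> nat \<Rightarrow> (nat \<Rightarrow> bool \<times> real \<times> nat) set" where
  "loss_event n \<phi> i = {\<omega> \<in> space (two_group_model \<alpha> \<beta> \<delta> p n). \<phi> (observed n \<omega>) i \<noteq> latent \<omega> i}"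

interpretation P: product_prob_space "\<lambda>_. two_group \<alpha> \<beta> \<delta> p" "{..<n}" for n
proof -
  interpret prob_space "two_group \<alpha> \<beta> \<delta> p" by (rule prob_space_two_group)
  show "product_prob_space (\<lambda>_. two_group \<alpha> \<beta> \<delta> p)" ..
qed

lemma prob_space_two_group_model: "prob_space (two_group_model \<alpha> \<beta> \<delta> p n)"
  unfolding two_group_model_def by (rule P.prob_space_axioms)

definition data_cell where
  "data_cell n i b v = {\<omega> \<in> space (two_group_model \<alpha> \<beta> \<delta> p n). (\<forall>j<n. snd (snd (\<omega> j)) = v j) \<and> fst (\<omega> i) = b}"

lemma data_cell_eq:
  assumes "i < n"
  shows "data_cell n i b v = PiE {..<n} (\<lambda>j. if j = i then {x. snd (snd x) = v i \<and> fst x = b} else {x. snd (snd x) = v j})"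
proof (intro set_eqI iffI)
  fix \<omega>
  assume "\<omega> \<in> data_cell n i b v"
  then show "\<omega> \<in> PiE {..<n} (\<lambda>j. if j = i then {x. snd (snd x) = v i \<and> fst x = b} else {x. snd (snd x) = v j})"
    using assms by (intro PiE_I) (simp_all add: data_cell_def two_group_model_def space_PiM PiE_iff extensional_def)
next
  fix \<omega> :: "nat \<Rightarrow> bool \<times> real \<times> nat"
  assume *: "\<omega> \<in> PiE {..<n} (\<lambda>j. if j = i then {x. snd (snd x) = v i \<and> fst x = b} else {x. snd (snd x) = v j})"
  have "snd (snd (\<omega> j)) = v j" if "j < n" for j
    using PiE_mem[OF *, of j] that by (cases "j = i") auto
  moreover have "fst (\<omega> i) = b"
    using PiE_mem[OF *, of i] assms by auto
  moreover have "\<omega> \<in> space (two_group_model \<alpha> \<beta> \<delta> p n)"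
    using * by (simp add: two_group_model_def space_PiM PiE_iff)
  ultimately show "\<omega> \<in> data_cell n i b v" by (simp add: data_cell_def)
qed

lemma sets_snd: "{x::bool\<times>real\<times>nat. snd (snd x) = y} \<in> sets triple_space"
proof -
  have "{x\<in>space triple_space. snd (snd x) = y} \<in> sets triple_space" by measurable
  then show ?thesis by (simp add: space_pair_measure)
qed

lemma sets_data_cell: "i < n \<Longrightarrow> data_cell n i b v \<in> sets (two_group_model \<alpha> \<beta> \<delta> p n)"
  unfolding two_group_model_def
  by (subst data_cell_eq, assumption, intro sets_PiM_I_finite) (auto simp: sets_fst_snd sets_snd)

lemma emeasure_data_cell:
  assumes "i < n"
  shows "emeasure (two_group_model \<alpha> \<beta> \<delta> p n) (data_cell n i b v) =
    emeasure (two_group \<alpha> \<beta> \<delta> p) {x. snd (snd x) = v i \<and> fst x = b} * (\<Prod>j\<in>{..<n}-{i}. emeasure (two_group \<alpha> \<beta> \<delta> p) {x. snd (snd x) = v j})"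
  unfolding data_cell_eq[OF assms] two_group_model_def
  using assms
  by (subst P.emeasure_PiM) (auto simp: sets_fst_snd sets_snd prod.remove[of "{..<n}" i] intro!: prod.cong arg_cong2[where f="(*)"])

lemma UN_data_cell:
  assumes "i < n"
  shows "{\<omega> \<in> space (two_group_model \<alpha> \<beta> \<delta> p n). Q (observed n \<omega>) (latent \<omega> i)} = 
   (\<Union>(v, b)\<in>{(v, b). v \<in> PiE {..<n} (\<lambda>_. UNIV) \<and> Q v b}. data_cell n i b v)" (is "?L = ?R")
proof
  show "?L \<subseteq> ?R"
  proof
    fix \<omega> assume "\<omega> \<in> ?L"
    then have "\<omega> \<in> data_cell n i (latent \<omega> i) (observed n \<omega>)" "observed n \<omega> \<in> PiE {..<n} (\<lambda>_. UNIV)"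
      "Q (observed n \<omega>) (latent \<omega> i)"
      by (auto simp: data_cell_def observed_def latent_def)
    then show "\<omega> \<in> ?R" by blast
  qed
  have "observed n \<omega> = v" if "\<omega> \<in> data_cell n i b v" "v \<in> PiE {..<n} (\<lambda>_. UNIV)" for \<omega> b v
    using that by (intro ext) (auto simp: data_cell_def observed_def PiE_def extensional_def)
  moreover have "\<omega> \<in> space (two_group_model \<alpha> \<beta> \<delta> p n) \<and> latent \<omega> i = b" if "\<omega> \<in> data_cell n i b v" for \<omega> b v
    using that by (simp add: data_cell_def latent_def)
  ultimately show "?R \<subseteq> ?L" by blast
qed

lemma countable_index: "countable {(v, b::bool). v \<in> PiE {..<n::nat} (\<lambda>_. UNIV::nat set) \<and> Q v b}"
proof (rule countable_subset)
  show "countable (PiE {..<n} (\<lambda>_. UNIV::nat set) \<times> (UNIV::bool set))"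
    by (intro countable_SIGMA countable_PiE) simp_all
qed blast

lemma sets_event:
  assumes "i < n"
  shows "{\<omega> \<in> space (two_group_model \<alpha> \<beta> \<delta> p n). Q (observed n \<omega>) (latent \<omega> i)} \<in> sets (two_group_model \<alpha> \<beta> \<delta> p n)"
proof (subst UN_data_cell[OF assms, of Q], rule sets.countable_UN'[OF countable_index], rule image_subsetI)
  fix x :: "(nat \<Rightarrow> nat) \<times> bool"
  show "(case x of (v, b) \<Rightarrow> data_cell n i b v) \<in> sets (two_group_model \<alpha> \<beta> \<delta> p n)"
    by (cases x) (simp only: prod.case sets_data_cell[OF assms])
qed

lemma neq_bool: "(P \<noteq> b) = (b = (\<not> P))" for b::bool by blast

lemma UN_bool_pair: "(\<Union>(v, b)\<in>{(v, b). v \<in> E \<and> f v \<noteq> b}. C b v) = (\<Union>v\<in>E. C (\<not> f v) v)"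
proof -
  have "{(v, b). v \<in> E \<and> f v \<noteq> b} = (\<lambda>v. (v, \<not> f v)) ` E"
    unfolding neq_bool by (rule set_eqI) (simp only: image_iff mem_Collect_eq split_paired_all prod.case prod.inject Bex_def, metis)
  then show ?thesis by (simp only: image_image prod.case)
qed

lemma emeasure_loss:
  assumes "i < n"
  shows "emeasure (two_group_model \<alpha> \<beta> \<delta> p n) (loss_event n \<phi> i) =
    (\<integral>\<^sup>+v. emeasure (two_group_model \<alpha> \<beta> \<delta> p n) (data_cell n i (\<not> \<phi> v i) v) \<partial>count_space (PiE {..<n} (\<lambda>_. UNIV)))"
proof -
  have "loss_event n \<phi> i = (\<Union>v\<in>PiE {..<n} (\<lambda>_. UNIV). data_cell n i (\<not> \<phi> v i) v)"
    unfolding loss_event_def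
    by (rule trans[OF UN_data_cell[OF assms, where Q = "\<lambda>v b. \<phi> v i \<noteq> b"] UN_bool_pair])
  also have "emeasure (two_group_model \<alpha> \<beta> \<delta> p n) \<dots> = (\<integral>\<^sup>+v. emeasure (two_group_model \<alpha> \<beta> \<delta> p n) (data_cell n i (\<not> \<phi> v i) v) \<partial>count_space (PiE {..<n} (\<lambda>_. UNIV)))"
  proof (rule emeasure_UN_countable)
    show "disjoint_family_on (\<lambda>v. data_cell n i (\<not> \<phi> v i) v) (PiE {..<n} (\<lambda>_. UNIV))"
    proof (unfold disjoint_family_on_def, intro ballI impI)
      fix v w :: "nat \<Rightarrow> nat"
      assume "v \<in> PiE {..<n} (\<lambda>_. UNIV)" "w \<in> PiE {..<n} (\<lambda>_. UNIV)" "v \<noteq> w"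
      then obtain j where j: "j \<in> {..<n}" "v j \<noteq> w j" using PiE_ext by blast
      show "data_cell n i (\<not> \<phi> v i) v \<inter> data_cell n i (\<not> \<phi> w i) w = {}"
      proof (rule equals0I)
        fix \<omega> assume "\<omega> \<in> data_cell n i (\<not> \<phi> v i) v \<inter> data_cell n i (\<not> \<phi> w i) w"
        then have "snd (snd (\<omega> j)) = v j" "snd (snd (\<omega> j)) = w j"
          using j(1) unfolding data_cell_def by blast+
        with j(2) show False by simp
      qed
    qed
    show "countable (PiE {..<n} (\<lambda>_. UNIV :: nat set))"
      by (rule countable_PiE) simp_all
    show "data_cell n i (\<not> \<phi> v i) v \<in> sets (two_group_model \<alpha> \<beta> \<delta> p n)" for v
      by (rule sets_data_cell[OF assms])
  qed
  finally show ?thesis .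
qed

lemma loss_oracle_le:
  assumes "i < n"
  shows "measure (two_group_model \<alpha> \<beta> \<delta> p n) (loss_event n (bayes_oracle \<alpha> \<beta> \<delta> p) i) \<le> measure (two_group_model \<alpha> \<beta> \<delta> p n) (loss_event n \<phi> i)"
proof -
  have T: "emeasure (two_group \<alpha> \<beta> \<delta> p) A = ennreal (measure (two_group \<alpha> \<beta> \<delta> p) A)" for A
    by (rule finite_measure.emeasure_eq_measure) (use prob_space_two_group in \<open>simp add: prob_space_def\<close>)
  interpret M: prob_space "two_group_model \<alpha> \<beta> \<delta> p n" by (rule prob_space_two_group_model)
  have "emeasure (two_group_model \<alpha> \<beta> \<delta> p n) (loss_event n (bayes_oracle \<alpha> \<beta> \<delta> p) i) \<le> emeasure (two_group_model \<alpha> \<beta> \<delta> p n) (loss_event n \<phi> i)"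
    unfolding emeasure_loss[OF assms] emeasure_data_cell[OF assms]
  proof (intro nn_integral_mono mult_right_mono)
    fix v :: "nat \<Rightarrow> nat"
    show "emeasure (two_group \<alpha> \<beta> \<delta> p) {x. snd (snd x) = v i \<and> fst x = (\<not> bayes_oracle \<alpha> \<beta> \<delta> p v i)} \<le>
          emeasure (two_group \<alpha> \<beta> \<delta> p) {x. snd (snd x) = v i \<and> fst x = (\<not> \<phi> v i)}"
      using oracle_iff[of v i] unfolding T
      by (intro ennreal_leI) (cases "\<phi> v i"; cases "bayes_oracle \<alpha> \<beta> \<delta> p v i"; simp)
  qed simp
  then show ?thesis by (simp add: M.emeasure_eq_measure)
qed

lemma prob_latent:
  assumes "i < n"
  shows "measure (two_group_model \<alpha> \<beta> \<delta> p n) {\<omega> \<in> space (two_group_model \<alpha> \<beta> \<delta> p n). latent \<omega> i = b} = (if b then p else 1 - p)"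
proof -
  have "emeasure (two_group_model \<alpha> \<beta> \<delta> p n) {\<omega> \<in> space (two_group_model \<alpha> \<beta> \<delta> p n). latent \<omega> i = b} = emeasure (two_group \<alpha> \<beta> \<delta> p) {x. fst x = b}"
    using P.emeasure_PiM_Collect_single[of i n "{x. fst x = b}"] assms
    by (simp add: two_group_model_def latent_def sets_fst)
  then show ?thesis using prob_fst[of b] by (simp add: measure_def)
qed

lemma bayes_risk_eq: "bayes_risk \<alpha> \<beta> \<delta> p n \<phi> = (\<Sum>i<n. measure (two_group_model \<alpha> \<beta> \<delta> p n) (loss_event n \<phi> i))"
  unfolding bayes_risk_def
proof (rule sum.cong[OF refl])
  fix i assume "i \<in> {..<n}"
  then have i: "i < n" by simp
  interpret M: prob_space "two_group_model \<alpha> \<beta> \<delta> p n" by (rule prob_space_two_group_model)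
  let ?A = "{\<omega> \<in> space (two_group_model \<alpha> \<beta> \<delta> p n). \<phi> (observed n \<omega>) i \<and> \<not> latent \<omega> i}"
  let ?B = "{\<omega> \<in> space (two_group_model \<alpha> \<beta> \<delta> p n). \<not> \<phi> (observed n \<omega>) i \<and> latent \<omega> i}"
  have "loss_event n \<phi> i = ?A \<union> ?B" by (auto simp: loss_event_def)
  moreover have "measure (two_group_model \<alpha> \<beta> \<delta> p n) (?A \<union> ?B) = measure (two_group_model \<alpha> \<beta> \<delta> p n) ?A + measure (two_group_model \<alpha> \<beta> \<delta> p n) ?B"
    by (rule M.finite_measure_Union) (use sets_event[OF i, of "\<lambda>v b. \<phi> v i \<and> \<not> b"] sets_event[OF i, of "\<lambda>v b. \<not> \<phi> v i \<and> b"] in auto)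
  ultimately show "(1 - p) * type1_error \<alpha> \<beta> \<delta> p n \<phi> i + p * type2_error \<alpha> \<beta> \<delta> p n \<phi> i = measure (two_group_model \<alpha> \<beta> \<delta> p n) (loss_event n \<phi> i)"
    using prob_latent[OF i, of True] prob_latent[OF i, of False] p
    by (simp add: type1_error_def type2_error_def cond_prob_def)
qed

lemma bayes_oracle_minimizes:
  "bayes_risk \<alpha> \<beta> \<delta> p n (bayes_oracle \<alpha> \<beta> \<delta> p) \<le> bayes_risk \<alpha> \<beta> \<delta> p n \<phi>"
  unfolding bayes_risk_eq by (intro sum_mono loss_oracle_le) auto

end

end

theory Submission
  imports Defs
begin

text \<open>
  All observations being exchangeable, the Bayes risk is \<open>n\<close> times the probability of a wrong
  decision about one coordinate. In every coordinate the signal strength separates two scales: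
  under the null hypothesis \<open>Y \<ge> 1\<close> has probability at most \<open>\<alpha> \<beta>\<close>, which is \<open>o(p)\<close> because
  \<open>\<beta>\<close> is proportional to a power of \<open>p\<close> with exponent above 1, whereas under the alternative \<open>Y\<close> converges in law
  to the negative binomial distribution with success probability \<open>1 / (\<delta> + 1)\<close>. Everything that
  happens with probability \<open>o(p)\<close> is negligible, so the only relevant errors are missed signals.

  The oracle accepts the null hypothesis at \<open>Y = 0\<close>, since there the null hypothesis has almost all
  the mass. Hence its risk is at least \<open>n p\<close> times the mass of the alternative at 0, which tends to
  \<open>1 / (\<delta> + 1)\<^sup>\<alpha>\<close> (\<open>bayes_risk_oracle_ge\<close>). This produces the factor \<open>(\<delta> + 1)\<^sup>\<alpha>\<close> in the bound.

  For the empirical Bayes rule, \<open>tau_hat\<close> is essentially the fraction of nonzero observations, whose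
  mean is \<open>O(p)\<close>; Markov's inequality for its square shows that \<open>tau_hat\<close> exceeds a fixed
  \<open>t > 0\<close> with probability \<open>O(p / n + p\<^sup>2) = o(p)\<close> (\<open>tau_hat_tail\<close>). So the rule may be studied
  for \<open>\<tau> \<rightarrow> 0\<close>, where the posterior mean of \<open>\<kappa>\<close> has a limit by dominated convergence: it is 1 for
  \<open>y = 0\<close> (\<open>kappa_posterior_mean_zero_tendsto\<close>), and it is the mean \<open>(a + \<alpha>) / (y + \<alpha>)\<close> of a Beta
  distribution for \<open>y > a\<close> (\<open>kappa_posterior_mean_tendsto\<close>). Consequently, for small \<open>\<tau>\<close>, the rule
  accepts at \<open>y = 0\<close> and rejects at each \<open>y\<close> above the number \<open>2a + \<alpha> - 2(a + \<alpha>)/(\<delta> + 2)\<close>, which is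
  the solution of \<open>1 - (a + \<alpha>)/(y + \<alpha>) = \<delta> / (2(\<delta> + 1))\<close>. How small \<open>\<tau>\<close> has to be
  depends on \<open>y\<close>, so the limit is used on a finite set \<open>G\<close> of values only, and a signal is counted
  as missed whenever \<open>Y \<notin> G\<close> (\<open>risk_ratio_limsup_le_truncated\<close>). Letting \<open>G\<close> exhaust the values above
  the threshold gives the upper bound. The lower bound 1 is the optimality of the oracle, once its
  risk is known to be positive.
\<close>

section \<open>The law of one observation\<close>

lemma nb_mass_eq_Gamma:
  assumes "0 < k"
  shows "nb_mass k q y = Gamma (k + real y) / (Gamma k * fact y) * (1 - q) ^ y * q powr k"
proof -
  have "k \<notin> \<int>\<^sub>\<le>\<^sub>0"
    using assms by (auto elim!: nonpos_Ints_cases)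
  then have "pochhammer k y = Gamma (k + real y) / Gamma k"
    by (rule pochhammer_Gamma)
  then show ?thesis
    by (simp add: nb_mass_def gbinomial_pochhammer')
qed

lemma nb_mass_nonneg:
  assumes "0 < k" "0 \<le> q" "q \<le> 1"
  shows "0 \<le> nb_mass k q y"
  using assms Gamma_real_pos[of k] Gamma_real_pos[of "k + real y"] by (simp add: nb_mass_eq_Gamma)

text \<open>
  Gamma priors are conjugate to the Poisson likelihood: the joint density is a multiple of the Gamma
  density of the posterior, so integrating \<open>\<theta>\<close> out is only a matter of normalization.
\<close>

lemma gamma_density_times_poisson:
  assumes "0 < k" "0 < s"
  shows "gamma_density k s \<theta> * pmf (poi \<theta>) y =
    nb_mass k (1 / (1 + s)) y * gamma_density (k + real y) (s / (1 + s)) \<theta>"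
proof (cases "0 < \<theta>")
  case True
  have "0 < k + real y"
    using assms by simp
  then have nz: "Gamma (k + real y) \<noteq> 0"
    using Gamma_real_pos by (metis less_irrefl)
  have "exp (- \<theta> / s) * exp (- \<theta>) = exp (- \<theta> / (s / (1 + s)))"
    using assms by (subst exp_add[symmetric]) (simp add: field_simps)
  moreover have "\<theta> powr (k - 1) * \<theta> ^ y = \<theta> powr (k + real y - 1)"
    using True by (simp add: powr_realpow[symmetric] powr_add[symmetric] algebra_simps)
  ultimately have "(\<theta> powr (k - 1) * \<theta> ^ y) * (exp (- \<theta> / s) * exp (- \<theta>)) =
      \<theta> powr (k + real y - 1) * exp (- \<theta> / (s / (1 + s)))"
    by simp
  then have lhs: "gamma_density k s \<theta> * pmf (poi \<theta>) y =
      \<theta> powr (k + real y - 1) * exp (- \<theta> / (s / (1 + s))) / (Gamma k * fact y * s powr k)"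
    using True by (simp add: gamma_density_def poi_def mult_ac)
  have "1 - 1 / (1 + s) = s / (1 + s)"
    using assms by (simp add: field_simps)
  then have "(1 - 1 / (1 + s)) ^ y * (1 / (1 + s)) powr k * s powr k
      = (s / (1 + s)) powr (k + real y)"
    using assms by (simp add: powr_add powr_realpow powr_divide power_divide mult.commute)
  then have "nb_mass k (1 / (1 + s)) y * (s powr k)
      = Gamma (k + real y) / (Gamma k * fact y) * (s / (1 + s)) powr (k + real y)"
    using assms by (simp add: nb_mass_eq_Gamma mult_ac)
  then have "nb_mass k (1 / (1 + s)) y = Gamma (k + real y) / (Gamma k * fact y)
      * (s / (1 + s)) powr (k + real y) / s powr k"
    by (intro eq_divide_imp) (use assms in simp)
  then show ?thesis
    unfolding lhs using True nz assms by (simp add: gamma_density_def)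
qed (simp add: gamma_density_def)

lemma sets_observation: "{x::bool \<times> real \<times> nat. snd (snd x) \<in> A} \<in> sets triple_space"
proof -
  have "{x \<in> space triple_space. snd (snd x) \<in> A} \<in> sets triple_space" by measurable
  then show ?thesis by (simp add: space_pair_measure)
qed

lemma sets_observation_latent:
  "{x::bool \<times> real \<times> nat. snd (snd x) \<in> A \<and> fst x = b} \<in> sets triple_space"
proof -
  have "{x \<in> space triple_space. snd (snd x) \<in> A \<and> fst x = b} \<in> sets triple_space" by measurable
  then show ?thesis by (simp add: space_pair_measure)
qed

text \<open>
  A group kernel describes a single group. Dummy values stand for the remaining parameters of the
  two-group model.
\<close>

lemmas emeasure_group_kernel_mixture = emeasure_group_kernel[where \<beta> = 1 and \<delta> = 1 and p = "1 / 2", simplified]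
lemmas group_kernel_is_probability = prob_space_group_kernel[where \<beta> = 1 and \<delta> = 1 and p = "1 / 2", simplified]

text \<open>
  Besides giving the marginal law of an observation, this is how \<^const>\<open>nb_distr\<close> is seen to be a
  probability distribution: it is the image of one.
\<close>

lemma distr_group_kernel_observation:
  assumes k: "0 < k" and s: "0 < s"
  shows "distr (group_kernel \<nu> k s) (count_space UNIV) (\<lambda>x. snd (snd x)) = nb_distr k (1 / (1 + s))"
proof (rule measure_eqI_countable[where A = UNIV])
  fix y :: nat
  have sets [measurable_cong]: "sets (group_kernel \<nu> k s) = sets triple_space"
    by (rule group_kernel_is_probability(2)[OF k s])
  have space: "space (group_kernel \<nu> k s) = UNIV"
    using sets_eq_imp_space_eq[OF sets] by (simp add: space_pair_measure)
  have s': "0 < s / (1 + s)" using s by simp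
  have "emeasure (distr (group_kernel \<nu> k s) (count_space UNIV) (\<lambda>x. snd (snd x))) {y} =
      emeasure (group_kernel \<nu> k s) {x. snd (snd x) \<in> {y}}"
    by (subst emeasure_distr) (auto simp: space intro!: arg_cong[where f = "emeasure _"])
  also have "\<dots> = (\<integral>\<^sup>+\<theta>. ennreal (gamma_density k s \<theta>) * ennreal (pmf (poi \<theta>) y) \<partial>lborel)"
    using emeasure_group_kernel_mixture[OF k sets_observation[of "{y}"] s, of \<nu>]
    by (simp add: emeasure_pmf_single)
  also have "\<dots> = (\<integral>\<^sup>+\<theta>. ennreal (nb_mass k (1 / (1 + s)) y)
      * ennreal (gamma_density (k + real y) (s / (1 + s)) \<theta>) \<partial>lborel)"
    using k s gamma_density_nonneg[OF k s] s'
    by (intro nn_integral_cong, simp flip: ennreal_mult'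
        add: gamma_density_times_poisson gamma_density_nonneg nb_mass_nonneg)
  also have "\<dots> = ennreal (nb_mass k (1 / (1 + s)) y)
      * emeasure (gamma_distr (k + real y) (s / (1 + s))) (space (gamma_distr (k + real y) (s / (1 + s))))"
    by (simp add: nn_integral_cmult gamma_distr_def emeasure_density)
  also have "\<dots> = ennreal (nb_mass k (1 / (1 + s)) y)"
    using prob_space.emeasure_space_1[OF prob_space_gamma_distr[OF _ s', of "k + real y"]] k by simp
  also have "\<dots> = emeasure (nb_distr k (1 / (1 + s))) {y}"
    by (simp add: nb_distr_def emeasure_density)
  finally show "emeasure (distr (group_kernel \<nu> k s) (count_space UNIV) (\<lambda>x. snd (snd x))) {y} =
      emeasure (nb_distr k (1 / (1 + s))) {y}" .
qed (simp_all add: nb_distr_def)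

lemma space_nb_distr [simp]: "space (nb_distr k q) = UNIV"
  and sets_nb_distr [simp]: "sets (nb_distr k q) = UNIV"
  by (simp_all add: nb_distr_def)

lemma prob_space_nb_distr:
  assumes "0 < k" "0 < s"
  shows "prob_space (nb_distr k (1 / (1 + s)))"
proof -
  have [measurable_cong]: "sets (group_kernel True k s) = sets triple_space"
    by (rule group_kernel_is_probability(2)[OF assms])
  show ?thesis
    unfolding distr_group_kernel_observation[OF assms, of True, symmetric]
    by (intro prob_space.prob_space_distr group_kernel_is_probability assms) simp
qed

lemma measure_nb_distr_singleton:
  assumes "0 < k" "0 < s"
  shows "measure (nb_distr k (1 / (1 + s))) {y} = nb_mass k (1 / (1 + s)) y"
  using assms by (simp add: measure_def nb_distr_def emeasure_density nb_mass_nonneg)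

lemma emeasure_group_kernel_observation:
  assumes k: "0 < k" and s: "0 < s"
  shows "emeasure (group_kernel \<nu> k s) {x. snd (snd x) \<in> A \<and> fst x = b} =
    (if \<nu> = b then emeasure (nb_distr k (1 / (1 + s))) A else 0)"
proof (cases "\<nu> = b")
  case True
  have sets [measurable_cong]: "sets (group_kernel \<nu> k s) = sets triple_space"
    by (rule group_kernel_is_probability(2)[OF k s])
  have space: "space (group_kernel \<nu> k s) = UNIV"
    using sets_eq_imp_space_eq[OF sets] by (simp add: space_pair_measure)
  have "emeasure (group_kernel \<nu> k s) {x. snd (snd x) \<in> A \<and> fst x = b} =
      emeasure (group_kernel \<nu> k s) {x. snd (snd x) \<in> A}"
    using True by (simp add: emeasure_group_kernel_mixture[OF k _ s] sets_observation sets_observation_latent)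
  also have "\<dots> = emeasure (distr (group_kernel \<nu> k s) (count_space UNIV) (\<lambda>x. snd (snd x))) A"
    by (subst emeasure_distr) (auto simp: space intro!: arg_cong[where f = "emeasure _"])
  finally show ?thesis
    using True by (simp add: distr_group_kernel_observation[OF k s])
next
  case False
  then show ?thesis
    by (simp add: emeasure_group_kernel_mixture[OF k _ s] sets_observation_latent)
qed

text \<open>
  The bound on the type I errors. It is linear in the scale, so it is \<open>o(p)\<close> when \<open>s = o(p)\<close>.
\<close>

lemma nb_distr_positive_le:
  assumes "0 < k" "0 < s"
  shows "measure (nb_distr k (1 / (1 + s))) {1..} \<le> k * s"
proof -
  interpret prob_space "nb_distr k (1 / (1 + s))"
    by (rule prob_space_nb_distr[OF assms])
  have "{1..} = space (nb_distr k (1 / (1 + s))) - {0::nat}"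
    by auto
  then have "prob {1..} = 1 - (1 / (1 + s)) powr k"
    using prob_compl[of "{0}"] measure_nb_distr_singleton[OF assms, of 0] by (simp add: nb_mass_def)
  also have "(1 / (1 + s)) powr k = exp (- (k * ln (1 + s)))"
    using assms by (simp add: powr_def ln_div)
  also have "1 - exp (- (k * ln (1 + s))) \<le> k * ln (1 + s)"
    using exp_ge_add_one_self[of "- (k * ln (1 + s))"] by simp
  also have "\<dots> \<le> k * s"
    using assms ln_add_one_self_le_self[of s] by simp
  finally show ?thesis .
qed

text \<open>
  Passing to the complement of a finite set reduces convergence in law to the pointwise convergence
  of finitely many mass functions.
\<close>

lemma measure_nb_distr_Compl_tendsto:
  assumes "0 < k" "0 < s" "finite G" and lim: "r \<longlonglongrightarrow> s" and r_pos: "\<And>n. 0 < r n"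
  shows "(\<lambda>n. measure (nb_distr k (1 / (1 + r n))) (- G)) \<longlonglongrightarrow> measure (nb_distr k (1 / (1 + s))) (- G)"
proof -
  have eq: "measure (nb_distr k (1 / (1 + x))) (- G) = 1 - (\<Sum>y\<in>G. nb_mass k (1 / (1 + x)) y)" if "0 < x" for x
  proof -
    interpret prob_space "nb_distr k (1 / (1 + x))"
      using assms that by (intro prob_space_nb_distr)
    have "prob (- G) = 1 - prob G"
      using prob_compl[of G] by (simp add: Compl_eq_Diff_UNIV)
    also have "prob G = (\<Sum>y\<in>G. prob {y})"
      using assms by (intro finite_measure_eq_sum_singleton) auto
    finally show ?thesis
      using measure_nb_distr_singleton[OF assms(1) that] by simp
  qed
  have "(\<lambda>n. 1 - (\<Sum>y\<in>G. nb_mass k (1 / (1 + r n)) y)) \<longlonglongrightarrow> 1 - (\<Sum>y\<in>G. nb_mass k (1 / (1 + s)) y)"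
    unfolding nb_mass_def using assms by (intro tendsto_intros lim) auto
  then show ?thesis
    using assms by (simp add: eq)
qed

section \<open>The posterior mean of the shrinkage weight as \<open>\<tau> \<rightarrow> 0\<close>\<close>

lemma kappa_kernel_measurable:
  assumes "L \<in> borel_measurable (restrict_space borel {0<..})"
  shows "(\<lambda>\<kappa>. indicator {0<..<1} \<kappa> *\<^sub>R kappa_kernel \<alpha> a L y \<tau> \<kappa>) \<in> borel_measurable borel"
proof (cases "\<tau> = 0")
  case True
  then show ?thesis by (simp add: kappa_kernel_def)
next
  case False
  have [measurable]: "(\<lambda>x. L x * indicator {0<..} x) \<in> borel_measurable borel"
    using assms by (simp add: borel_measurable_restrict_space_iff mult.commute)
  have "(\<lambda>\<kappa>. indicator {0<..<1} \<kappa> *\<^sub>R kappa_kernel \<alpha> a L y \<tau> \<kappa>) = (\<lambda>\<kappa>. indicator {0<..<1} \<kappa> *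
      (\<kappa> powr (a + \<alpha> - 1) * (1 - \<kappa>) powr (real y - a - 1)
       * (\<lambda>x. L x * indicator {0<..} x) (1 / \<tau>\<^sup>2 * (1 / \<kappa> - 1))))"
    using False by (intro ext) (auto simp: kappa_kernel_def indicator_def field_simps)
  also have "\<dots> \<in> borel_measurable borel"
    by measurable
  finally show ?thesis .
qed

lemma kappa_times_kappa_kernel:
  "0 < \<kappa> \<Longrightarrow> \<kappa> * kappa_kernel \<alpha> a L y \<tau> \<kappa> = kappa_kernel (\<alpha> + 1) a L y \<tau> \<kappa>"
  using powr_mult_base[of \<kappa> "a + \<alpha> - 1"] by (simp add: kappa_kernel_def add_ac)

text \<open>
  The numerator of the posterior mean is itself a normalizing integral, with \<open>\<alpha> + 1\<close> in place
  of \<open>\<alpha>\<close>; only normalizing integrals need to be studied below.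
\<close>

lemma kappa_posterior_mean_eq_ratio:
  "kappa_posterior_mean \<alpha> a L y \<tau> =
    (LBINT \<kappa>:{0<..<1}. kappa_kernel (\<alpha> + 1) a L y \<tau> \<kappa>) / (LBINT \<kappa>:{0<..<1}. kappa_kernel \<alpha> a L y \<tau> \<kappa>)"
proof -
  have "(LBINT \<kappa>:{0<..<1}. \<kappa> * kappa_kernel \<alpha> a L y \<tau> \<kappa>) =
      (LBINT \<kappa>:{0<..<1}. kappa_kernel (\<alpha> + 1) a L y \<tau> \<kappa>)"
    by (intro set_lebesgue_integral_cong) (simp_all add: kappa_times_kappa_kernel)
  then show ?thesis by (simp add: kappa_posterior_mean_def)
qed

text \<open>
  The passage from the local variance \<open>x = \<lambda>\<^sup>2\<close> to \<open>\<kappa>\<close>, which turns integrals over \<open>(0, 1)\<close> back into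
  integrals against the prior.
\<close>

lemma bij_betw_shrinkage_weight:
  fixes \<tau> :: real
  assumes "0 < \<tau>"
  shows "bij_betw (\<lambda>x. 1 / (1 + x * \<tau>\<^sup>2)) {0<..} {0<..<1}"
proof (rule bij_betw_byWitness[where f' = "\<lambda>\<kappa>. 1 / \<tau>\<^sup>2 * (1 / \<kappa> - 1)"])
  show "\<forall>x\<in>{0<..}. 1 / \<tau>\<^sup>2 * (1 / (1 / (1 + x * \<tau>\<^sup>2)) - 1) = x"
    using assms by simp
  show "\<forall>\<kappa>\<in>{0<..<1}. 1 / (1 + 1 / \<tau>\<^sup>2 * (1 / \<kappa> - 1) * \<tau>\<^sup>2) = \<kappa>"
    using assms by simp
  have "1 < 1 + x * \<tau>\<^sup>2" if "0 < x" for x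
    using assms that by simp
  then show "(\<lambda>x. 1 / (1 + x * \<tau>\<^sup>2)) ` {0<..} \<subseteq> {0<..<1}"
    by (smt (verit) divide_less_eq_1_pos greaterThanLessThan_iff greaterThan_iff image_subsetI zero_less_divide_1_iff)
  show "(\<lambda>\<kappa>. 1 / \<tau>\<^sup>2 * (1 / \<kappa> - 1)) ` {0<..<1} \<subseteq> {0<..}"
    using assms by auto
qed

text \<open>
  For \<open>y = 0\<close> and \<open>a > 0\<close> the factor \<open>(1 - \<kappa>) powr (- a - 1)\<close> is not integrable at \<open>\<kappa> = 1\<close>; only the decay
  of \<open>L\<close> at 0, forced by the normalization of the prior, makes the kernel integrable. In the variable
  \<open>x = \<lambda>\<^sup>2\<close> this is evident, because the integrand is the prior density times a power of
  \<open>1 + x \<tau>\<^sup>2\<close>, up to a constant, and this power is bounded for \<open>\<alpha> \<ge> 0\<close>. The diverging factor \<open>\<tau>\<^sup>2 powr (- a)\<close> cancels in the posterior mean.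
\<close>

lemma integral_kappa_kernel_zero:
  assumes \<tau>: "0 < \<tau>" and L: "L \<in> borel_measurable (restrict_space borel {0<..})"
    and int: "set_integrable lborel {0<..} (\<lambda>x. x powr (- a - 1) * L x * (1 + x * \<tau>\<^sup>2) powr (- \<alpha>))"
  shows "(LBINT \<kappa>:{0<..<1}. kappa_kernel \<alpha> a L 0 \<tau> \<kappa>) =
    \<tau>\<^sup>2 powr (- a) * (LBINT x:{0<..}. x powr (- a - 1) * L x * (1 + x * \<tau>\<^sup>2) powr (- \<alpha>))"
proof -
  let ?g = "\<lambda>x. 1 / (1 + x * \<tau>\<^sup>2)" and ?g' = "\<lambda>x. - \<tau>\<^sup>2 / (1 + x * \<tau>\<^sup>2)\<^sup>2"
  let ?h = "kappa_kernel \<alpha> a L 0 \<tau>"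
  let ?H = "\<lambda>x. \<tau>\<^sup>2 powr (- a) * (x powr (- a - 1) * L x * (1 + x * \<tau>\<^sup>2) powr (- \<alpha>))"
  have gt: "1 < 1 + x * \<tau>\<^sup>2" if "0 < x" for x
    using that \<tau> by simp
  have transformed: "\<bar>?g' x\<bar> * ?h (?g x) = ?H x" if x: "0 < x" for x
  proof -
    define u where "u = 1 + x * \<tau>\<^sup>2"
    have u: "0 < u" using gt[OF x] by (simp add: u_def)
    have "1 - 1 / u = x * \<tau>\<^sup>2 / u"
      using u by (simp add: field_simps) (simp add: u_def)
    moreover have "1 / \<tau>\<^sup>2 * (1 / (1 / u) - 1) = x"
      using \<tau> u by (simp add: u_def)
    ultimately have "\<bar>?g' x\<bar> * ?h (?g x) =
        \<tau>\<^sup>2 / u\<^sup>2 * ((1 / u) powr (a + \<alpha> - 1) * (x * \<tau>\<^sup>2 / u) powr (- a - 1) * L x)"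
      using u by (simp add: kappa_kernel_def u_def[symmetric] abs_divide)
    also have "\<dots> = (\<tau>\<^sup>2 powr 1 * \<tau>\<^sup>2 powr (- a - 1)) * (x powr (- a - 1) * L x)
        * (u powr (-2) * u powr (- (a + \<alpha> - 1)) * u powr (a + 1))"
      using u x \<tau> by (simp add: powr_mult powr_divide powr_minus_divide powr_numeral powr_diff powr_add field_simps)
    also have "\<dots> = \<tau>\<^sup>2 powr (- a) * (x powr (- a - 1) * L x) * u powr (- \<alpha>)"
      unfolding powr_add[symmetric] by (simp add: algebra_simps)
    finally show ?thesis by (simp add: u_def mult_ac)
  qed
  have deriv: "(?g has_field_derivative ?g' x) (at x within {0<..})" if "x \<in> {0<..}" for x
    using gt[of x] that by (auto intro!: derivative_eq_intros simp: power2_eq_square)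
  have "set_integrable lborel {0<..} ?H"
    using int by simp
  then have "?H absolutely_integrable_on {0<..}"
    unfolding set_integrable_def by (subst integrable_completion) auto
  moreover have "?H absolutely_integrable_on {0<..} \<longleftrightarrow> (\<lambda>x. \<bar>?g' x\<bar> * ?h (?g x)) absolutely_integrable_on {0<..}"
    by (intro set_integrable_cong) (simp_all only: transformed greaterThan_iff)
  moreover have "integral {0<..} (\<lambda>x. \<bar>?g' x\<bar> * ?h (?g x)) = integral {0<..} ?H"
    by (intro integral_cong) (simp only: transformed greaterThan_iff)
  ultimately have h: "?h absolutely_integrable_on ?g ` {0<..} \<and> integral (?g ` {0<..}) ?h = integral {0<..} ?H"
    using has_absolute_integral_change_of_variables_1'[of "{0<..}" ?g ?g' ?h "integral {0<..} ?H"] deriv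
      bij_betw_shrinkage_weight[OF \<tau>] by (simp add: bij_betw_def)
  have image: "?g ` {0<..} = {0<..<1}"
    using bij_betw_shrinkage_weight[OF \<tau>] by (simp add: bij_betw_def)
  have "set_integrable lborel {0<..<1} ?h"
    using h kappa_kernel_measurable[OF L, of \<alpha> a 0 \<tau>] unfolding image set_integrable_def
    by (subst (asm) integrable_completion) auto
  then have "(LBINT \<kappa>:{0<..<1}. ?h \<kappa>) = integral {0<..<1} ?h"
    by (rule set_borel_integral_eq_integral(2))
  also have "\<dots> = integral {0<..} ?H"
    using h by (simp add: image)
  also have "\<dots> = (LBINT x:{0<..}. ?H x)"
    using \<open>set_integrable lborel {0<..} ?H\<close> by (rule set_borel_integral_eq_integral(2)[symmetric])
  also have "\<dots> = \<tau>\<^sup>2 powr (- a) * (LBINT x:{0<..}. x powr (- a - 1) * L x * (1 + x * \<tau>\<^sup>2) powr (- \<alpha>))"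
    by simp
  finally show ?thesis .
qed

text \<open>
  By the change of variables the posterior mean is
  \<open>(\<integral>W(x) (1 + x \<tau>\<^sup>2) powr (- \<alpha> - 1)) / (\<integral>W(x) (1 + x \<tau>\<^sup>2) powr (- \<alpha>))\<close>, where \<open>W\<close> is the prior
  density up to a constant. Both integrals are dominated by \<open>\<integral>W\<close> and tend to it.
\<close>

lemma kappa_posterior_mean_zero_tendsto:
  assumes prior: "one_group_prior a L K" and \<alpha>: "0 < \<alpha>"
  shows "((\<lambda>\<tau>. kappa_posterior_mean \<alpha> a L 0 \<tau>) \<longlongrightarrow> 1) (at_right 0)"
proof -
  define W where "W = (\<lambda>x. indicator {0<..} x * (x powr (- a - 1) * L x))"
  have L: "L \<in> borel_measurable (restrict_space borel {0<..})" and L_pos: "\<And>x. 0 < x \<Longrightarrow> 0 < L x"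
    and K: "0 < K" and norm: "(\<integral>\<^sup>+x\<in>{0<..}. ennreal (K * x powr (- a - 1) * L x) \<partial>lborel) = 1"
    using prior by (auto simp: one_group_prior_def)
  have [measurable]: "(\<lambda>x. indicator {0<..} x * L x) \<in> borel_measurable borel"
    using L by (simp add: borel_measurable_restrict_space_iff)
  have "W = (\<lambda>x. x powr (- a - 1) * (indicator {0<..} x * L x))"
    by (auto simp: W_def)
  then have W_meas [measurable]: "W \<in> borel_measurable borel"
    by simp
  have W_nonneg: "0 \<le> W x" for x
    using L_pos[of x] by (auto simp: W_def indicator_def less_imp_le)
  have "(\<integral>\<^sup>+x. ennreal (K * W x) \<partial>lborel) = 1"
    unfolding norm[symmetric] by (intro nn_integral_cong) (auto simp: W_def indicator_def mult_ac)
  then have "has_bochner_integral lborel (\<lambda>x. K * W x) 1"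
    using W_nonneg K by (intro has_bochner_integral_nn_integral) (auto simp: less_imp_le)
  then have W_int: "integrable lborel W" and W_pos: "(\<integral>x. W x \<partial>lborel) \<noteq> 0"
    using K by (auto simp: has_bochner_integral_iff)
  \<comment> \<open>The maximum keeps the power at most 1 at negative arguments as well, where \<open>W\<close> vanishes.\<close>
  define J where "J = (\<lambda>r \<tau>. \<integral>x. W x * (1 + max 0 x * \<tau>\<^sup>2) powr (- r) \<partial>lborel)"
  have J_bound: "norm (W x * (1 + max 0 x * \<tau>\<^sup>2) powr (- r)) \<le> W x" if "0 < r" for r x \<tau>
  proof -
    have "(1 + max 0 x * \<tau>\<^sup>2) powr (- r) \<le> 1"
      using that powr_mono_both[of "-r" 0 1 "1 + max 0 x * \<tau>\<^sup>2"]
      by (simp add: powr_minus inverse_le_1_iff ge_one_powr_ge_zero)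
    then show ?thesis
      using W_nonneg[of x] by (simp add: abs_mult mult_left_le)
  qed
  have J_integrable: "integrable lborel (\<lambda>x. W x * (1 + max 0 x * \<tau>\<^sup>2) powr (- r))" if "0 < r" for r \<tau>
    by (rule Bochner_Integration.integrable_bound[OF W_int]) (use J_bound[OF that] W_nonneg in auto)
  have J_lim: "(J r \<longlongrightarrow> (\<integral>x. W x \<partial>lborel)) (at_right 0)" if r: "0 < r" for r
    unfolding filterlim_at_right_to_top J_def
  proof (rule integral_dominated_convergence_at_top[where w = W])
    show "AE x in lborel. ((\<lambda>t. W x * (1 + max 0 x * (inverse t)\<^sup>2) powr (- r)) \<longlongrightarrow> W x) at_top"
    proof (rule AE_I2)
      fix x :: real
      have "((\<lambda>t. W x * (1 + max 0 x * (inverse t)\<^sup>2) powr (- r)) \<longlongrightarrow> W x * (1 + max 0 x * 0\<^sup>2) powr (- r)) at_top"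
        by (intro tendsto_intros tendsto_inverse_0_at_top filterlim_ident) simp
      then show "((\<lambda>t. W x * (1 + max 0 x * (inverse t)\<^sup>2) powr (- r)) \<longlongrightarrow> W x) at_top"
        by simp
    qed
  qed (use J_bound[OF r] W_int in auto)
  have kernel: "(LBINT \<kappa>:{0<..<1}. kappa_kernel r a L 0 \<tau> \<kappa>) = \<tau>\<^sup>2 powr (- a) * J r \<tau>"
    if "0 < r" "0 < \<tau>" for r \<tau>
  proof -
    have eq: "indicator {0<..} x *\<^sub>R (x powr (- a - 1) * L x * (1 + x * \<tau>\<^sup>2) powr (- r))
        = W x * (1 + max 0 x * \<tau>\<^sup>2) powr (- r)" for x
      by (auto simp: W_def indicator_def)
    show ?thesis
      using integral_kappa_kernel_zero[OF that(2) L] J_integrable[OF that(1), of \<tau>]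
      by (simp only: set_integrable_def set_lebesgue_integral_def eq J_def)
  qed
  have "((\<lambda>\<tau>. J (\<alpha> + 1) \<tau> / J \<alpha> \<tau>) \<longlongrightarrow> (\<integral>x. W x \<partial>lborel) / (\<integral>x. W x \<partial>lborel)) (at_right 0)"
    using \<alpha> W_pos by (intro tendsto_divide J_lim) auto
  then have "((\<lambda>\<tau>. J (\<alpha> + 1) \<tau> / J \<alpha> \<tau>) \<longlongrightarrow> 1) (at_right 0)"
    using W_pos by simp
  moreover have "\<forall>\<^sub>F \<tau> in at_right 0. J (\<alpha> + 1) \<tau> / J \<alpha> \<tau> = kappa_posterior_mean \<alpha> a L 0 \<tau>"
    using eventually_at_right_less[of 0]
    by eventually_elim (use \<alpha> in \<open>simp add: kappa_posterior_mean_eq_ratio kernel\<close>)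
  ultimately show ?thesis
    by (rule Lim_transform_eventually)
qed

text \<open>
  For \<open>y > a\<close> the kernel without \<open>L\<close> is an integrable Beta kernel, and the argument of \<open>L\<close> tends to
  infinity as \<open>\<tau> \<rightarrow> 0\<close>. So the boundedness of \<open>L\<close> provides the dominating function and its limit at
  infinity provides the limit.
\<close>

lemma kappa_kernel_integral_tendsto_Beta:
  assumes L: "L \<in> borel_measurable (restrict_space borel {0<..})"
    and L_pos: "\<And>x. 0 < x \<Longrightarrow> 0 \<le> L x" and L_le: "\<And>x. 0 < x \<Longrightarrow> L x \<le> M" and lim: "(L \<longlongrightarrow> l) at_top"
    and r: "0 < a + r" and y: "a < real y"
  shows "((\<lambda>\<tau>. LBINT \<kappa>:{0<..<1}. kappa_kernel r a L y \<tau> \<kappa>) \<longlongrightarrow> l * Beta (a + r) (real y - a)) (at_right 0)"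
proof -
  let ?b = "\<lambda>\<kappa>::real. \<kappa> powr (a + r - 1) * (1 - \<kappa>) powr (real y - a - 1)"
  have b_int: "set_integrable lborel {0<..<1} ?b"
    by (rule set_integrable_subset[OF integrable_Beta]) (use r y in auto)
  have "(?b has_integral Beta (a + r) (real y - a)) {0<..<1}"
    using has_integral_Beta_real[of "a + r" "real y - a"] r y by (simp add: has_integral_Icc_iff_Ioo)
  then have b_eq: "(LBINT \<kappa>:{0<..<1}. ?b \<kappa>) = Beta (a + r) (real y - a)"
    using set_borel_integral_eq_integral(2)[OF b_int] by (simp add: integral_unique)
  have "((\<lambda>t. LBINT \<kappa>:{0<..<1}. kappa_kernel r a L y (inverse t) \<kappa>) \<longlongrightarrow> (LBINT \<kappa>:{0<..<1}. l * ?b \<kappa>)) at_top"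
    unfolding set_lebesgue_integral_def
  proof (rule integral_dominated_convergence_at_top[where w = "\<lambda>\<kappa>. indicator {0<..<1} \<kappa> *\<^sub>R (M * ?b \<kappa>)"])
    show "AE \<kappa> in lborel. ((\<lambda>t. indicator {0<..<1} \<kappa> *\<^sub>R kappa_kernel r a L y (inverse t) \<kappa>)
        \<longlongrightarrow> indicator {0<..<1} \<kappa> *\<^sub>R (l * ?b \<kappa>)) at_top"
    proof (rule AE_I2)
      fix \<kappa> :: real
      show "((\<lambda>t. indicator {0<..<1} \<kappa> *\<^sub>R kappa_kernel r a L y (inverse t) \<kappa>)
        \<longlongrightarrow> indicator {0<..<1} \<kappa> *\<^sub>R (l * ?b \<kappa>)) at_top"
      proof (cases "\<kappa> \<in> {0<..<1}")
        case True
        have "filterlim (\<lambda>t::real. 1 / (inverse t)\<^sup>2 * (1 / \<kappa> - 1)) at_top at_top"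
        proof -
          have "filterlim (\<lambda>t::real. (1 / \<kappa> - 1) * t ^ 2) at_top at_top"
            using True by (intro filterlim_tendsto_pos_mult_at_top[OF tendsto_const] filterlim_pow_at_top filterlim_ident) auto
          then show ?thesis by (simp add: power_inverse divide_inverse mult.commute)
        qed
        then have "((\<lambda>t. L (1 / (inverse t)\<^sup>2 * (1 / \<kappa> - 1))) \<longlongrightarrow> l) at_top"
          by (rule filterlim_compose[OF lim])
        then have "((\<lambda>t. ?b \<kappa> * L (1 / (inverse t)\<^sup>2 * (1 / \<kappa> - 1))) \<longlongrightarrow> ?b \<kappa> * l) at_top"
          by (rule tendsto_mult[OF tendsto_const])
        then show ?thesis
          using True by (simp add: kappa_kernel_def mult.commute)
      qed simp
    qed
    have "norm (indicator {0<..<1} \<kappa> *\<^sub>R kappa_kernel r a L y (inverse t) \<kappa>) \<le> indicator {0<..<1} \<kappa> *\<^sub>R (M * ?b \<kappa>)"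
      if "0 < t" for t \<kappa>
    proof (cases "\<kappa> \<in> {0<..<1}")
      case True
      then have "0 < 1 / (inverse t)\<^sup>2 * (1 / \<kappa> - 1)"
        using that by simp
      from L_pos[OF this] L_le[OF this] True show ?thesis
        by (simp add: kappa_kernel_def abs_mult mult.commute mult_right_mono)
    qed simp
    then show "\<forall>\<^sub>F t in at_top. AE \<kappa> in lborel. norm (indicator {0<..<1} \<kappa> *\<^sub>R kappa_kernel r a L y (inverse t) \<kappa>)
        \<le> indicator {0<..<1} \<kappa> *\<^sub>R (M * ?b \<kappa>)"
      by (intro eventually_mono[OF eventually_gt_at_top[of 0]] AE_I2) blast
    show "integrable lborel (\<lambda>\<kappa>. indicator {0<..<1} \<kappa> *\<^sub>R (M * ?b \<kappa>))"
      using b_int unfolding set_integrable_def[symmetric] by simp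
  qed (use kappa_kernel_measurable[OF L] in auto)
  then show ?thesis
    unfolding filterlim_at_right_to_top by (simp add: b_eq)
qed

lemma kappa_posterior_mean_tendsto:
  assumes prior: "one_group_prior a L K" and \<alpha>: "0 < \<alpha>" and a: "0 < a" and y: "a < real y"
    and A1: "condition_A1 L" and A2: "condition_A2 L"
  shows "((\<lambda>\<tau>. kappa_posterior_mean \<alpha> a L y \<tau>) \<longlongrightarrow> (a + \<alpha>) / (real y + \<alpha>)) (at_right 0)"
proof -
  obtain l where l: "0 < l" "(L \<longlongrightarrow> l) at_top"
    using A1 by (auto simp: condition_A1_def)
  obtain M where M: "\<And>x. 0 < x \<Longrightarrow> L x \<le> M"
    using A2 by (auto simp: condition_A2_def)
  have L: "L \<in> borel_measurable (restrict_space borel {0<..})" and L_pos: "\<And>x. 0 < x \<Longrightarrow> 0 \<le> L x"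
    using prior by (auto simp: one_group_prior_def less_imp_le)
  let ?B = "\<lambda>r. l * Beta (a + r) (real y - a)"
  have lim: "((\<lambda>\<tau>. LBINT \<kappa>:{0<..<1}. kappa_kernel r a L y \<tau> \<kappa>) \<longlongrightarrow> ?B r) (at_right 0)" if "0 < r" for r
    by (rule kappa_kernel_integral_tendsto_Beta[OF L L_pos M l(2)]) (use that a y in auto)
  have Beta_pos: "0 < Beta (a + \<alpha>) (real y - a)"
    using a \<alpha> y by (simp add: Beta_def)
  have "(a + \<alpha> + (real y - a)) * Beta (a + \<alpha> + 1) (real y - a) = (a + \<alpha>) * Beta (a + \<alpha>) (real y - a)"
    using a \<alpha> by (intro Beta_plus1_left) (auto elim!: nonpos_Ints_cases)
  then have "?B (\<alpha> + 1) / ?B \<alpha> = (a + \<alpha>) / (real y + \<alpha>)"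
    using l(1) Beta_pos a \<alpha> y by (simp add: field_simps)
  moreover have "((\<lambda>\<tau>. kappa_posterior_mean \<alpha> a L y \<tau>) \<longlongrightarrow> ?B (\<alpha> + 1) / ?B \<alpha>) (at_right 0)"
    unfolding kappa_posterior_mean_eq_ratio
    using \<alpha> l(1) Beta_pos by (intro tendsto_divide lim) auto
  ultimately show ?thesis by simp
qed

text \<open>
  The origin of the threshold in the theorem. It exceeds \<open>a\<close>, so the limit of the posterior mean
  just found applies to every \<open>y\<close> above it.
\<close>

lemma posterior_threshold:
  fixes \<alpha> \<delta> a y :: real
  assumes "0 < \<alpha>" "0 < \<delta>" "0 < a" "2 * a + \<alpha> - 2 * (a + \<alpha>) / (\<delta> + 2) < y"
  shows "a < y" "\<delta> / (2 * (\<delta> + 1)) < 1 - (a + \<alpha>) / (y + \<alpha>)"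
proof -
  have bound: "2 * a * (\<delta> + 1) + \<alpha> * \<delta> < y * (\<delta> + 2)"
    using assms by (simp add: field_simps)
  moreover have "a * (\<delta> + 2) < 2 * a * (\<delta> + 1) + \<alpha> * \<delta>"
    using assms by (simp add: algebra_simps add_pos_pos)
  ultimately have "a * (\<delta> + 2) < y * (\<delta> + 2)" by linarith
  then show "a < y" using assms by simp
  then have "0 < y + \<alpha>" using assms by simp
  then show "\<delta> / (2 * (\<delta> + 1)) < 1 - (a + \<alpha>) / (y + \<alpha>)"
    using bound assms by (simp add: field_simps)
qed

section \<open>Bayes risks at a fixed sample size\<close>

context
  fixes \<alpha> \<beta> \<delta> p :: real
  assumes par: "0 < \<alpha>" "0 < \<beta>" "0 < \<delta>" "0 < p" "p < 1"
begin

interpretation M: prob_space "two_group_model \<alpha> \<beta> \<delta> p n" for n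
  by (rule prob_space_two_group_model[OF par])

interpretation T: prob_space "two_group \<alpha> \<beta> \<delta> p"
  by (rule prob_space_two_group[OF par])

interpretation P: product_prob_space "\<lambda>_. two_group \<alpha> \<beta> \<delta> p" "{..<n}" for n
  by unfold_locales

lemma measure_two_group_observation:
  "measure (two_group \<alpha> \<beta> \<delta> p) {x. snd (snd x) \<in> A \<and> fst x = b} =
    (if b then p * measure (nb_distr \<alpha> (1 / (1 + (\<beta> + \<delta>)))) A
     else (1 - p) * measure (nb_distr \<alpha> (1 / (1 + \<beta>))) A)"
  using par
  by (simp add: measure_def emeasure_two_group[OF par sets_observation_latent]
      emeasure_group_kernel_observation enn2real_mult)

text \<open>
  Independence of the coordinates. It is used for a single coordinate and for pairs of coordinates.
\<close>

lemma measure_two_group_model_coordinates: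
  assumes "J \<subseteq> {..<n}" "A \<in> sets triple_space"
  shows "measure (two_group_model \<alpha> \<beta> \<delta> p n) {\<omega> \<in> space (two_group_model \<alpha> \<beta> \<delta> p n). \<forall>i\<in>J. \<omega> i \<in> A}
    = measure (two_group \<alpha> \<beta> \<delta> p) A ^ card J"
proof -
  have "emeasure (two_group_model \<alpha> \<beta> \<delta> p n) {\<omega> \<in> space (two_group_model \<alpha> \<beta> \<delta> p n). \<forall>i\<in>J. \<omega> i \<in> A}
      = (\<Prod>i\<in>J. emeasure (two_group \<alpha> \<beta> \<delta> p) A)"
    unfolding two_group_model_def
    using assms finite_subset[OF assms(1)] par by (intro P.emeasure_PiM_Collect) auto
  then show ?thesis
    by (simp add: T.emeasure_eq_measure M.emeasure_eq_measure ennreal_power)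
qed

interpretation NB1: prob_space "nb_distr \<alpha> (1 / (1 + (\<beta> + \<delta>)))"
  using par by (intro prob_space_nb_distr) auto

lemma measure_two_group_positive_le:
  "measure (two_group \<alpha> \<beta> \<delta> p) {x. snd (snd x) \<in> {1..}} \<le> \<alpha> * \<beta> + p"
proof -
  have "{x::bool \<times> real \<times> nat. snd (snd x) \<in> {1..}}
      = {x. snd (snd x) \<in> {1..} \<and> fst x = True} \<union> {x. snd (snd x) \<in> {1..} \<and> fst x = False}"
    by auto
  then have "T.prob {x. snd (snd x) \<in> {1..}} \<le> T.prob {x. snd (snd x) \<in> {1..} \<and> fst x = True}
      + T.prob {x. snd (snd x) \<in> {1..} \<and> fst x = False}"
    by (simp only:) (rule measure_Un_le; simp only: sets_two_group[OF par] sets_observation_latent)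
  also have "\<dots> \<le> p * 1 + 1 * (\<alpha> * \<beta>)"
    unfolding measure_two_group_observation if_True if_False
    using par by (intro add_mono mult_mono nb_distr_positive_le NB1.prob_le_1) auto
  finally show ?thesis by simp
qed

text \<open>
  For \<open>n t > 1\<close> the event says that at least \<open>n t\<close> observations are nonzero. Their number \<open>S\<close> has second
  moment at most \<open>n q + n\<^sup>2 q\<^sup>2\<close>, where \<open>q = O(p)\<close> is the probability of a nonzero observation. A first
  moment bound would only give \<open>O(p)\<close>, which is not negligible.
\<close>

lemma tau_hat_tail:
  assumes n: "1 / real n < t" "0 < n"
  shows "measure (two_group_model \<alpha> \<beta> \<delta> p n)
      {\<omega> \<in> space (two_group_model \<alpha> \<beta> \<delta> p n). t \<le> tau_hat n (observed n \<omega>)}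
    \<le> ((\<alpha> * \<beta> + p) / real n + (\<alpha> * \<beta> + p)\<^sup>2) / t\<^sup>2"
proof -
  let ?M = "two_group_model \<alpha> \<beta> \<delta> p n"
  let ?B = "{x::bool \<times> real \<times> nat. snd (snd x) \<in> {1..}}"
  define q where "q = measure (two_group \<alpha> \<beta> \<delta> p) ?B"
  define E where "E = (\<lambda>j k. {\<omega> \<in> space ?M. \<forall>i\<in>{j, k}. \<omega> i \<in> ?B})"
  \<comment> \<open>On the sample space this is the square of the number of nonzero observations.\<close>
  define u where "u = (\<lambda>\<omega>. \<Sum>j<n. \<Sum>k<n. indicator (E j k) \<omega> :: real)"
  have t: "0 < t" using n by (meson less_trans zero_less_divide_1_iff of_nat_0_less_iff)
  have q: "0 \<le> q" "q \<le> \<alpha> * \<beta> + p"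
    unfolding q_def by (rule measure_nonneg, rule measure_two_group_positive_le)
  have coordinate: "(\<lambda>\<omega>. \<omega> i) \<in> ?M \<rightarrow>\<^sub>M two_group \<alpha> \<beta> \<delta> p" if "i < n" for i
    unfolding two_group_model_def using that by (intro measurable_component_singleton) simp
  have B: "?B \<in> sets (two_group \<alpha> \<beta> \<delta> p)"
    using sets_observation[of "{1..}"] by (simp add: sets_two_group[OF par] del: atLeast_iff)
  have E_sets: "E j k \<in> sets ?M" if "j < n" "k < n" for j k
  proof -
    have "E j k = (\<lambda>\<omega>. \<omega> j) -` ?B \<inter> space ?M \<inter> ((\<lambda>\<omega>. \<omega> k) -` ?B \<inter> space ?M)"
      by (auto simp: E_def)
    then show ?thesis
      using measurable_sets[OF coordinate[OF that(1)] B] measurable_sets[OF coordinate[OF that(2)] B] by simp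
  qed
  have E_prob: "measure ?M (E j k) = q ^ card {j, k}" if "j < n" "k < n" for j k
    unfolding E_def q_def using that
    by (intro measure_two_group_model_coordinates sets_observation) auto
  have int_u: "(\<integral>\<omega>. u \<omega> \<partial>?M) = (\<Sum>j<n. \<Sum>k<n. q ^ card {j, k})"
    unfolding u_def using E_sets
    by (subst Bochner_Integration.integral_sum)
       (auto intro!: sum.cong Bochner_Integration.integrable_sum integrable_real_indicator
         simp: Bochner_Integration.integral_sum E_prob M.emeasure_eq_measure)
  also have "\<dots> \<le> (\<Sum>j<n. \<Sum>k<n. (if k = j then q else 0) + q\<^sup>2)"
    using q by (intro sum_mono) (auto simp: card_insert_if power2_eq_square)
  also have "\<dots> = real n * q + (real n)\<^sup>2 * q\<^sup>2"
    by (simp add: sum.distrib power2_eq_square algebra_simps)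
  finally have int_le: "(\<integral>\<omega>. u \<omega> \<partial>?M) \<le> real n * q + (real n)\<^sup>2 * q\<^sup>2" .
  have u_eq: "u \<omega> = (\<Sum>j<n. of_bool (1 \<le> observed n \<omega> j))\<^sup>2" if "\<omega> \<in> space ?M" for \<omega>
    unfolding u_def power2_eq_square sum_product using that
    by (intro sum.cong) (auto simp: E_def observed_def)
  have "{\<omega> \<in> space ?M. t \<le> tau_hat n (observed n \<omega>)} \<subseteq> {\<omega> \<in> space ?M. (real n * t)\<^sup>2 \<le> u \<omega>}"
  proof safe
    fix \<omega> assume \<omega>: "\<omega> \<in> space ?M" and "t \<le> tau_hat n (observed n \<omega>)"
    then have "real n * t \<le> (\<Sum>j<n. of_bool (1 \<le> observed n \<omega> j))"
      using n by (auto simp: tau_hat_def max_def field_simps split: if_splits)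
    then show "(real n * t)\<^sup>2 \<le> u \<omega>"
      unfolding u_eq[OF \<omega>] using n t by (intro power_mono) auto
  qed
  moreover have u_meas: "integrable ?M u"
    unfolding u_def using E_sets
    by (intro Bochner_Integration.integrable_sum integrable_real_indicator) (auto simp: M.emeasure_eq_measure)
  ultimately have "measure ?M {\<omega> \<in> space ?M. t \<le> tau_hat n (observed n \<omega>)}
      \<le> measure ?M {\<omega> \<in> space ?M. (real n * t)\<^sup>2 \<le> u \<omega>}"
    using borel_measurable_integrable[OF u_meas] by (intro M.finite_measure_mono) auto
  also have "\<dots> \<le> (\<integral>\<omega>. u \<omega> \<partial>?M) / (real n * t)\<^sup>2"
    using u_meas n t
    by (intro integral_Markov_inequality_measure[where A = "{}"]) (auto simp: u_def intro!: sum_nonneg)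
  also have "\<dots> \<le> (real n * q + (real n)\<^sup>2 * q\<^sup>2) / (real n * t)\<^sup>2"
    by (intro divide_right_mono int_le) simp
  also have "\<dots> = (q / real n + q\<^sup>2) / t\<^sup>2"
    using n t by (simp add: field_simps power2_eq_square)
  also have "\<dots> \<le> ((\<alpha> * \<beta> + p) / real n + (\<alpha> * \<beta> + p)\<^sup>2) / t\<^sup>2"
    using q by (intro divide_right_mono add_mono power_mono) auto
  finally show ?thesis .
qed

lemma measure_observation_latent:
  assumes "i < n"
  shows "measure (two_group_model \<alpha> \<beta> \<delta> p n)
      {\<omega> \<in> space (two_group_model \<alpha> \<beta> \<delta> p n). observed n \<omega> i \<in> A \<and> latent \<omega> i = b} =
    (if b then p * measure (nb_distr \<alpha> (1 / (1 + (\<beta> + \<delta>)))) A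
     else (1 - p) * measure (nb_distr \<alpha> (1 / (1 + \<beta>))) A)"
proof -
  have "{\<omega> \<in> space (two_group_model \<alpha> \<beta> \<delta> p n). observed n \<omega> i \<in> A \<and> latent \<omega> i = b} =
      {\<omega> \<in> space (two_group_model \<alpha> \<beta> \<delta> p n). \<forall>i\<in>{i}. \<omega> i \<in> {x. snd (snd x) \<in> A \<and> fst x = b}}"
    using assms by (auto simp: observed_def latent_def)
  also have "measure (two_group_model \<alpha> \<beta> \<delta> p n) \<dots> =
      measure (two_group \<alpha> \<beta> \<delta> p) {x. snd (snd x) \<in> A \<and> fst x = b} ^ card {i}"
    using assms by (intro measure_two_group_model_coordinates sets_observation_latent) simp
  finally show ?thesis
    by (simp only: measure_two_group_observation) simp
qed

text \<open>
  As long as \<open>tau_hat < t\<close>, a wrong decision requires a nonzero observation under the null hypothesis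
  or an observation outside \<open>G\<close> under the alternative. The three summands bound the probabilities of
  these two events and of \<open>tau_hat \<ge> t\<close>. The last event is bounded unconditionally, so the
  dependence between \<open>tau_hat\<close> and the coordinate under test does not matter.
\<close>

lemma bayes_risk_eb_rule_le:
  assumes n: "1 / real n < t" "0 < n"
    and accept: "\<And>\<tau>. 0 < \<tau> \<Longrightarrow> \<tau> < t \<Longrightarrow> 1 - kappa_posterior_mean \<alpha> a L 0 \<tau> \<le> \<delta> / (2 * (\<delta> + 1))"
    and reject: "\<And>y \<tau>. y \<in> G \<Longrightarrow> 0 < \<tau> \<Longrightarrow> \<tau> < t \<Longrightarrow> \<delta> / (2 * (\<delta> + 1)) < 1 - kappa_posterior_mean \<alpha> a L y \<tau>"
  shows "bayes_risk \<alpha> \<beta> \<delta> p n (eb_rule \<alpha> \<delta> a L n) \<le>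
    real n * (\<alpha> * \<beta> + p * measure (nb_distr \<alpha> (1 / (1 + (\<beta> + \<delta>)))) (- G)
      + ((\<alpha> * \<beta> + p) / real n + (\<alpha> * \<beta> + p)\<^sup>2) / t\<^sup>2)"
proof -
  let ?M = "two_group_model \<alpha> \<beta> \<delta> p n"
  let ?bound = "\<alpha> * \<beta> + p * measure (nb_distr \<alpha> (1 / (1 + (\<beta> + \<delta>)))) (- G)
      + ((\<alpha> * \<beta> + p) / real n + (\<alpha> * \<beta> + p)\<^sup>2) / t\<^sup>2"
  have "measure ?M (loss_event \<alpha> \<beta> \<delta> p n (eb_rule \<alpha> \<delta> a L n) i) \<le> ?bound" if i: "i < n" for i
  proof -
    let ?A = "\<lambda>A b. {\<omega> \<in> space ?M. observed n \<omega> i \<in> A \<and> latent \<omega> i = b}"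
    let ?C = "{\<omega> \<in> space ?M. t \<le> tau_hat n (observed n \<omega>)}"
    have sets: "?A A b \<in> sets ?M" "?C \<in> sets ?M" for A b
      using sets_event[OF par i, of "\<lambda>v c. v i \<in> A \<and> c = b"] sets_event[OF par i, of "\<lambda>v c. t \<le> tau_hat n v"]
      by auto
    have "loss_event \<alpha> \<beta> \<delta> p n (eb_rule \<alpha> \<delta> a L n) i \<subseteq> (?A {1..} False \<union> ?A (- G) True) \<union> ?C"
    proof
      fix \<omega> assume \<omega>: "\<omega> \<in> loss_event \<alpha> \<beta> \<delta> p n (eb_rule \<alpha> \<delta> a L n) i"
      let ?y = "observed n \<omega> i" and ?\<tau> = "tau_hat n (observed n \<omega>)"
      have \<tau>: "0 < ?\<tau>"
        using n by (simp add: tau_hat_def less_max_iff_disj)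
      have space: "\<omega> \<in> space ?M" and loss: "eb_rule \<alpha> \<delta> a L n (observed n \<omega>) i \<noteq> latent \<omega> i"
        using \<omega> by (auto simp: loss_event_def[OF par])
      show "\<omega> \<in> (?A {1..} False \<union> ?A (- G) True) \<union> ?C"
      proof (cases "?\<tau> < t")
        case small: True
        show ?thesis
        proof (cases "latent \<omega> i")
          case True
          then have "?y \<notin> G"
            using loss reject[of ?y ?\<tau>] \<tau> small by (auto simp: eb_rule_def)
          then show ?thesis using space True by simp
        next
          case False
          then have "?y \<noteq> 0"
            using loss accept[of ?\<tau>] \<tau> small by (intro notI) (simp add: eb_rule_def)
          then show ?thesis using space False by simp
        qed
      qed (use space in simp)
    qed
    then have "measure ?M (loss_event \<alpha> \<beta> \<delta> p n (eb_rule \<alpha> \<delta> a L n) i)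
        \<le> measure ?M ((?A {1..} False \<union> ?A (- G) True) \<union> ?C)"
      by (intro M.finite_measure_mono sets sets.Un)
    also have "\<dots> \<le> (measure ?M (?A {1..} False) + measure ?M (?A (- G) True)) + measure ?M ?C"
      by (intro order_trans[OF measure_Un_le] add_mono sets sets.Un order_refl)
    also have "\<dots> \<le> ?bound"
    proof (intro add_mono tau_hat_tail[OF n])
      have "(1 - p) * measure (nb_distr \<alpha> (1 / (1 + \<beta>))) {1..} \<le> 1 * (\<alpha> * \<beta>)"
        using par by (intro mult_mono nb_distr_positive_le) auto
      then show "measure ?M (?A {1..} False) \<le> \<alpha> * \<beta>"
        unfolding measure_observation_latent[OF i] by simp
    qed (simp only: measure_observation_latent[OF i] if_True order_refl)
    finally show ?thesis .
  qed
  then have "bayes_risk \<alpha> \<beta> \<delta> p n (eb_rule \<alpha> \<delta> a L n) \<le> (\<Sum>i<n. ?bound)"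
    unfolding bayes_risk_eq[OF par] by (intro sum_mono) simp
  then show ?thesis by simp
qed

text \<open>
  Under the assumption the null hypothesis is at least as likely as the alternative at \<open>Y = 0\<close>, so the oracle
  errs at every signal with \<open>Y = 0\<close>.
\<close>

lemma bayes_risk_oracle_ge:
  assumes "p \<le> (1 - p) * (1 / (1 + \<beta>)) powr \<alpha>"
  shows "real n * (p * (1 / (1 + (\<beta> + \<delta>))) powr \<alpha>) \<le> bayes_risk \<alpha> \<beta> \<delta> p n (bayes_oracle \<alpha> \<beta> \<delta> p)"
proof -
  let ?M = "two_group_model \<alpha> \<beta> \<delta> p n"
  let ?f = "(1 / (1 + (\<beta> + \<delta>))) powr \<alpha>"
  have f: "measure (nb_distr \<alpha> (1 / (1 + s))) {0} = (1 / (1 + s)) powr \<alpha>" if "0 < s" for s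
    using measure_nb_distr_singleton[OF par(1) that, of 0] by (simp add: nb_mass_def)
  have f1: "measure (nb_distr \<alpha> (1 / (1 + (\<beta> + \<delta>)))) {0} = ?f"
    using par by (intro f) simp
  have "?f \<le> 1"
    unfolding f1[symmetric] by simp
  have no_reject: "\<not> bayes_oracle \<alpha> \<beta> \<delta> p Y i" if "Y i = 0" for Y i
  proof -
    have "p * ?f \<le> (1 - p) * (1 / (1 + \<beta>)) powr \<alpha>"
      using assms mult_left_le[OF \<open>?f \<le> 1\<close>, of p] par(4) by linarith
    then show ?thesis
      using measure_two_group_observation[of "{0}" True] measure_two_group_observation[of "{0}" False]
        f1 f[OF par(2)] that
      by (simp add: oracle_iff[OF par])
  qed
  have "p * ?f \<le> measure ?M (loss_event \<alpha> \<beta> \<delta> p n (bayes_oracle \<alpha> \<beta> \<delta> p) i)" if i: "i < n" for i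
  proof -
    have "p * ?f = measure ?M {\<omega> \<in> space ?M. observed n \<omega> i \<in> {0} \<and> latent \<omega> i = True}"
      unfolding measure_observation_latent[OF i] by (simp add: f1)
    also have "\<dots> \<le> measure ?M (loss_event \<alpha> \<beta> \<delta> p n (bayes_oracle \<alpha> \<beta> \<delta> p) i)"
      using sets_event[OF par i, of "\<lambda>v b. bayes_oracle \<alpha> \<beta> \<delta> p v i \<noteq> b"]
      by (intro M.finite_measure_mono) (auto simp: loss_event_def[OF par] no_reject)
    finally show ?thesis .
  qed
  then have "(\<Sum>i<n. p * ?f) \<le> bayes_risk \<alpha> \<beta> \<delta> p n (bayes_oracle \<alpha> \<beta> \<delta> p)"
    unfolding bayes_risk_eq[OF par] by (intro sum_mono) simp
  then show ?thesis by simp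
qed

end

section \<open>Asymptotic comparison of the risks\<close>

lemma eventually_at_right_common_radius:
  assumes "finite F" and "\<And>y. y \<in> F \<Longrightarrow> \<forall>\<^sub>F \<tau> in at_right (0::real). P y \<tau>"
  shows "\<exists>t>0. \<forall>y\<in>F. \<forall>\<tau>. 0 < \<tau> \<longrightarrow> \<tau> < t \<longrightarrow> P y \<tau>"
proof -
  have "\<forall>\<^sub>F \<tau> in at_right (0::real). \<forall>y\<in>F. P y \<tau>"
    using assms by (simp add: eventually_ball_finite)
  then show ?thesis
    by (auto simp: eventually_at_right_field)
qed

lemma assumption1_rates:
  assumes "assumption1 \<alpha> \<beta> \<delta> p"
  shows "(\<lambda>n. \<beta> n / p n) \<longlonglongrightarrow> 0" "\<beta> \<longlonglongrightarrow> 0"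
proof -
  have p: "\<And>n. 0 < p n" and p_lim: "p \<longlonglongrightarrow> 0"
    using assms by (auto simp: assumption1_def)
  obtain C1 c where C1: "1 < C1" and c: "0 < c" "\<forall>\<^sub>F n in sequentially. \<beta> n = c * p n powr C1"
    using assms by (auto simp: assumption1_def eventually_proportional_def)
  have "(\<lambda>n. c * p n powr (C1 - 1)) \<longlonglongrightarrow> c * 0"
    using C1 p by (intro tendsto_intros tendsto_zero_powrI p_lim) (auto simp: less_imp_le)
  moreover have "\<forall>\<^sub>F n in sequentially. c * p n powr (C1 - 1) = \<beta> n / p n"
    using c(2) by eventually_elim (simp add: powr_diff less_imp_le[OF p] less_imp_neq[OF p, symmetric])
  ultimately show ratio: "(\<lambda>n. \<beta> n / p n) \<longlonglongrightarrow> 0"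
    by (auto intro: Lim_transform_eventually)
  have "(\<lambda>n. \<beta> n / p n * p n) \<longlonglongrightarrow> 0 * 0"
    by (intro tendsto_mult ratio p_lim)
  then show "\<beta> \<longlonglongrightarrow> 0"
    using p by (simp add: less_imp_neq[symmetric])
qed

lemma assumption1_oracle_accepts_zero:
  assumes "assumption1 \<alpha> \<beta> \<delta> p"
  shows "\<forall>\<^sub>F n in sequentially. p n \<le> (1 - p n) * (1 / (1 + \<beta> n)) powr \<alpha>"
proof -
  have "p \<longlonglongrightarrow> 0"
    using assms by (simp add: assumption1_def)
  then have "(\<lambda>n. (1 - p n) * (1 / (1 + \<beta> n)) powr \<alpha> - p n) \<longlonglongrightarrow> (1 - 0) * (1 / (1 + 0)) powr \<alpha> - 0"
    by (intro tendsto_intros assumption1_rates(2)[OF assms]) auto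
  then have "\<forall>\<^sub>F n in sequentially. 0 < (1 - p n) * (1 / (1 + \<beta> n)) powr \<alpha> - p n"
    by (rule order_tendstoD(1)) simp
  then show ?thesis
    by eventually_elim simp
qed

text \<open>
  The finite set \<open>G\<close> admits one \<open>t\<close> below which the rule rejects on all of \<open>G\<close>. Dividing the upper bound
  for the empirical Bayes risk by the lower bound for the oracle risk, all terms but the probability of
  \<open>- G\<close> vanish in the limit.
\<close>

lemma risk_ratio_limsup_le_truncated:
  fixes \<alpha> \<delta> a K :: real and p \<beta> :: "nat \<Rightarrow> real" and L :: "real \<Rightarrow> real"
  assumes A: "assumption1 \<alpha> \<beta> \<delta> p" and a: "0 < a" and prior: "one_group_prior a L K"
    and L: "condition_A1 L" "condition_A2 L"
    and G: "finite G" "\<And>y. y \<in> G \<Longrightarrow> 2 * a + \<alpha> - 2 * (a + \<alpha>) / (\<delta> + 2) < real y"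
  shows "limsup (\<lambda>n. ereal (bayes_risk \<alpha> (\<beta> n) \<delta> (p n) n (eb_rule \<alpha> \<delta> a L n)
        / bayes_risk \<alpha> (\<beta> n) \<delta> (p n) n (bayes_oracle \<alpha> (\<beta> n) \<delta> (p n))))
    \<le> ereal ((\<delta> + 1) powr \<alpha> * measure (nb_distr \<alpha> (1 / (1 + \<delta>))) (- G))"
proof -
  have p: "\<And>n. 0 < p n" "\<And>n. p n < 1" and p_lim: "p \<longlonglongrightarrow> 0"
    and \<alpha>: "0 < \<alpha>" and \<delta>: "0 < \<delta>" and \<beta>: "\<And>n. 0 < \<beta> n"
    using A by (auto simp: assumption1_def)
  note par = \<alpha> \<beta> \<delta> p
  note \<beta>_lim = assumption1_rates[OF A]
  have "\<forall>\<^sub>F \<tau> in at_right 0. 1 - \<delta> / (2 * (\<delta> + 1)) < kappa_posterior_mean \<alpha> a L 0 \<tau>"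
    using \<delta> by (intro order_tendstoD(1)[OF kappa_posterior_mean_zero_tendsto[OF prior \<alpha>]]) simp
  then obtain t0 where t0: "0 < t0"
    "\<And>\<tau>. 0 < \<tau> \<Longrightarrow> \<tau> < t0 \<Longrightarrow> 1 - \<delta> / (2 * (\<delta> + 1)) < kappa_posterior_mean \<alpha> a L 0 \<tau>"
    by (auto simp: eventually_at_right_field)
  have "\<forall>\<^sub>F \<tau> in at_right 0. kappa_posterior_mean \<alpha> a L y \<tau> < 1 - \<delta> / (2 * (\<delta> + 1))" if "y \<in> G" for y
    using posterior_threshold[OF \<alpha> \<delta> a G(2)[OF that]]
    by (intro order_tendstoD(2)[OF kappa_posterior_mean_tendsto[OF prior \<alpha> a _ L]]) auto
  then obtain t1 where t1: "0 < t1"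
    "\<And>y \<tau>. y \<in> G \<Longrightarrow> 0 < \<tau> \<Longrightarrow> \<tau> < t1 \<Longrightarrow> kappa_posterior_mean \<alpha> a L y \<tau> < 1 - \<delta> / (2 * (\<delta> + 1))"
    using eventually_at_right_common_radius[OF G(1), of "\<lambda>y \<tau>. kappa_posterior_mean \<alpha> a L y \<tau> < 1 - \<delta> / (2 * (\<delta> + 1))"]
    by blast
  define t where "t = min t0 t1"
  have t: "0 < t" using t0 t1 by (simp add: t_def)
  \<comment> \<open>The bounds divided by \<open>n p\<close>: \<open>D n\<close> comes from the oracle, and \<open>U n\<close> is the resulting bound on the ratio.\<close>
  define D where "D = (\<lambda>n. (1 / (1 + (\<beta> n + \<delta>))) powr \<alpha>)"
  define e where "e = (\<lambda>n. \<alpha> * (\<beta> n / p n))"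
  define U where "U = (\<lambda>n. (e n + measure (nb_distr \<alpha> (1 / (1 + (\<beta> n + \<delta>)))) (- G)
      + (e n + 1) * (1 / real n + (\<alpha> * \<beta> n + p n)) / t\<^sup>2) / D n)"
  have "\<forall>\<^sub>F n in sequentially. 1 / real n < t"
    using lim_1_over_n[where 'a = real] t by (rule order_tendstoD(2))
  moreover note assumption1_oracle_accepts_zero[OF A]
  ultimately have "\<forall>\<^sub>F n in sequentially. bayes_risk \<alpha> (\<beta> n) \<delta> (p n) n (eb_rule \<alpha> \<delta> a L n)
        / bayes_risk \<alpha> (\<beta> n) \<delta> (p n) n (bayes_oracle \<alpha> (\<beta> n) \<delta> (p n)) \<le> U n"
    using eventually_gt_at_top[of 0]
  proof eventually_elim
    case (elim n)
    let ?EB = "bayes_risk \<alpha> (\<beta> n) \<delta> (p n) n (eb_rule \<alpha> \<delta> a L n)"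
    let ?opt = "bayes_risk \<alpha> (\<beta> n) \<delta> (p n) n (bayes_oracle \<alpha> (\<beta> n) \<delta> (p n))"
    let ?m = "measure (nb_distr \<alpha> (1 / (1 + (\<beta> n + \<delta>)))) (- G)"
    have D: "0 < D n" using \<beta>[of n] \<delta> by (simp add: D_def)
    have "?EB \<le> real n * (\<alpha> * \<beta> n + p n * ?m
        + ((\<alpha> * \<beta> n + p n) / real n + (\<alpha> * \<beta> n + p n)\<^sup>2) / t\<^sup>2)"
    proof (rule bayes_risk_eb_rule_le[OF par elim(1,3)])
      show "1 - kappa_posterior_mean \<alpha> a L 0 \<tau> \<le> \<delta> / (2 * (\<delta> + 1))" if "0 < \<tau>" "\<tau> < t" for \<tau>
        using t0(2)[of \<tau>] that by (simp add: t_def)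
      show "\<delta> / (2 * (\<delta> + 1)) < 1 - kappa_posterior_mean \<alpha> a L y \<tau>" if "y \<in> G" "0 < \<tau>" "\<tau> < t" for y \<tau>
        using t1(2)[of y \<tau>] that by (simp add: t_def)
    qed
    also have "\<dots> = U n * (real n * (p n * D n))"
      using p(1)[of n] D t elim(3) by (simp add: U_def e_def field_simps power2_eq_square)
    finally have EB: "?EB \<le> U n * (real n * (p n * D n))" .
    have opt: "real n * (p n * D n) \<le> ?opt"
      unfolding D_def using elim(2) by (rule bayes_risk_oracle_ge[OF par])
    have pos: "0 < real n * (p n * D n)"
      using elim(3) p(1)[of n] D by simp
    have "0 \<le> U n"
      unfolding U_def e_def using D p(1)[of n] \<alpha> \<beta>[of n]
      by (intro divide_nonneg_nonneg add_nonneg_nonneg mult_nonneg_nonneg) (auto simp: less_imp_le)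
    then have "?EB \<le> U n * ?opt"
      using EB opt by (meson mult_left_mono order_trans)
    then show "?EB / ?opt \<le> U n"
      using pos opt by (simp add: divide_le_eq)
  qed
  then have "limsup (\<lambda>n. ereal (bayes_risk \<alpha> (\<beta> n) \<delta> (p n) n (eb_rule \<alpha> \<delta> a L n)
        / bayes_risk \<alpha> (\<beta> n) \<delta> (p n) n (bayes_oracle \<alpha> (\<beta> n) \<delta> (p n)))) \<le> limsup (\<lambda>n. ereal (U n))"
    by (intro Limsup_mono) simp
  also have "limsup (\<lambda>n. ereal (U n)) = ereal ((\<delta> + 1) powr \<alpha> * measure (nb_distr \<alpha> (1 / (1 + \<delta>))) (- G))"
  proof (rule lim_imp_Limsup)
    have shift: "(\<lambda>n. \<beta> n + \<delta>) \<longlonglongrightarrow> \<delta>"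
      using tendsto_add[OF \<beta>_lim(2) tendsto_const[of \<delta>]] by simp
    have e_lim: "e \<longlonglongrightarrow> 0"
      unfolding e_def using tendsto_mult[OF tendsto_const[of \<alpha>] \<beta>_lim(1)] by simp
    have "(\<lambda>n. measure (nb_distr \<alpha> (1 / (1 + (\<beta> n + \<delta>)))) (- G)) \<longlonglongrightarrow> measure (nb_distr \<alpha> (1 / (1 + \<delta>))) (- G)"
      using \<delta> \<beta> by (intro measure_nb_distr_Compl_tendsto \<alpha> \<delta> G(1) shift) (simp add: add_pos_pos)
    then have "U \<longlonglongrightarrow> (0 + measure (nb_distr \<alpha> (1 / (1 + \<delta>))) (- G)
      + (0 + 1) * (0 + (\<alpha> * 0 + 0)) / t\<^sup>2) / (1 / (1 + \<delta>)) powr \<alpha>"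
      unfolding U_def D_def using t \<delta>
      by (intro tendsto_intros e_lim lim_1_over_n \<beta>_lim p_lim shift) auto
    moreover have "(0 + measure (nb_distr \<alpha> (1 / (1 + \<delta>))) (- G)
      + (0 + 1) * (0 + (\<alpha> * 0 + 0)) / t\<^sup>2) / (1 / (1 + \<delta>)) powr \<alpha>
      = (\<delta> + 1) powr \<alpha> * measure (nb_distr \<alpha> (1 / (1 + \<delta>))) (- G)"
      using \<delta> by (simp add: powr_divide field_simps add_ac)
    ultimately show "(\<lambda>n. ereal (U n)) \<longlonglongrightarrow> ereal ((\<delta> + 1) powr \<alpha> * measure (nb_distr \<alpha> (1 / (1 + \<delta>))) (- G))"
      by simp
  qed simp
  finally show ?thesis .
qed

theorem theorem3:
  fixes \<alpha> \<delta> a K \<epsilon> :: real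
    and p \<beta> :: "nat \<Rightarrow> real"
    and L :: "real \<Rightarrow> real"
    and R_EB R_opt :: "nat \<Rightarrow> real"
  assumes "assumption1 \<alpha> \<beta> \<delta> p"
    and "0 < \<epsilon>" and "\<epsilon> < 1" and "p \<propto> (\<lambda>n. real n powr (- \<epsilon>))"
    and "1 < a" and "one_group_prior a L K"
    and "condition_A1 L" and "condition_A2 L"
  defines "R_EB \<equiv> \<lambda>n. bayes_risk \<alpha> (\<beta> n) \<delta> (p n) n (eb_rule \<alpha> \<delta> a L n)"
    and "R_opt \<equiv> \<lambda>n. bayes_risk \<alpha> (\<beta> n) \<delta> (p n) n (bayes_oracle \<alpha> (\<beta> n) \<delta> (p n))"
  shows "1 \<le> liminf (\<lambda>n. ereal (R_EB n / R_opt n))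
    \<and> liminf (\<lambda>n. ereal (R_EB n / R_opt n)) \<le> limsup (\<lambda>n. ereal (R_EB n / R_opt n))
    \<and> limsup (\<lambda>n. ereal (R_EB n / R_opt n))
        \<le> ereal ((\<delta> + 1) powr \<alpha> *
            \<P>(y in nb_distr \<alpha> (1 / (\<delta> + 1)). real y \<le> 2 * a + \<alpha> - 2 * (a + \<alpha>) / (\<delta> + 2)))"
proof (intro conjI)
  have par: "0 < \<alpha>" "0 < \<beta> n" "0 < \<delta>" "0 < p n" "p n < 1" for n
    using assms(1) by (auto simp: assumption1_def)
  show "1 \<le> liminf (\<lambda>n. ereal (R_EB n / R_opt n))"
  proof (rule Liminf_bounded)
    note assumption1_oracle_accepts_zero[OF assms(1)]
    then show "\<forall>\<^sub>F n in sequentially. 1 \<le> ereal (R_EB n / R_opt n)"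
      using eventually_gt_at_top[of 0]
    proof eventually_elim
      case (elim n)
      have "0 < real n * (p n * (1 / (1 + (\<beta> n + \<delta>))) powr \<alpha>)"
        using elim(2) par(2)[of n] par(3) par(4)[of n] by simp
      also have "\<dots> \<le> R_opt n"
        unfolding R_opt_def using elim(1) by (rule bayes_risk_oracle_ge[OF par])
      finally have "0 < R_opt n" .
      moreover have "R_opt n \<le> R_EB n"
        unfolding R_opt_def R_EB_def by (rule bayes_oracle_minimizes[OF par])
      ultimately show ?case
        by simp
    qed
  qed
  show "liminf (\<lambda>n. ereal (R_EB n / R_opt n)) \<le> limsup (\<lambda>n. ereal (R_EB n / R_opt n))"
    by (rule Liminf_le_Limsup) simp
  let ?z = "2 * a + \<alpha> - 2 * (a + \<alpha>) / (\<delta> + 2)"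
  let ?NB = "nb_distr \<alpha> (1 / (1 + \<delta>))"
  \<comment> \<open>The values above the threshold, truncated to a finite set; they exhaust all of them as \<open>N\<close> grows.\<close>
  define G where "G = (\<lambda>N. {y. ?z < real y \<and> y \<le> (N::nat)})"
  interpret NB: prob_space ?NB
    using par by (intro prob_space_nb_distr)
  have "(\<lambda>N. NB.prob (- G N)) \<longlonglongrightarrow> NB.prob (\<Inter>N. - G N)"
    by (intro NB.finite_Lim_measure_decseq) (auto simp: G_def decseq_def)
  also have "(\<Inter>N. - G N) = {y. real y \<le> ?z}"
    by (auto simp: G_def not_less)
  finally have lim: "(\<lambda>N. ereal ((\<delta> + 1) powr \<alpha> * NB.prob (- G N)))
      \<longlonglongrightarrow> ereal ((\<delta> + 1) powr \<alpha> * NB.prob {y. real y \<le> ?z})"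
    by (intro tendsto_intros) simp_all
  have "limsup (\<lambda>n. ereal (R_EB n / R_opt n)) \<le> ereal ((\<delta> + 1) powr \<alpha> * NB.prob (- G N))" for N
    unfolding R_EB_def R_opt_def
  proof (rule risk_ratio_limsup_le_truncated[OF assms(1) _ assms(6-8)])
    show "finite (G N)"
      by (rule finite_subset[of _ "{..N}"]) (auto simp: G_def)
  qed (use \<open>1 < a\<close> in \<open>auto simp: G_def\<close>)
  then have "limsup (\<lambda>n. ereal (R_EB n / R_opt n)) \<le> ereal ((\<delta> + 1) powr \<alpha> * NB.prob {y. real y \<le> ?z})"
    by (intro LIMSEQ_le_const[OF lim] exI allI impI)
  then show "limsup (\<lambda>n. ereal (R_EB n / R_opt n))
        \<le> ereal ((\<delta> + 1) powr \<alpha> * \<P>(y in nb_distr \<alpha> (1 / (\<delta> + 1)). real y \<le> ?z))"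
    by (simp add: add.commute)
qed

end
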